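(* Let $U=(U_0,U_1^{\top})^{\top}$ be a $(d+1)$-dimensional random variable, with $U_0$ of dimension $1$ and $U_1$ of dimension $d$, having elliptical density $\mathcal{E}_{d+1}(0,\Omega_+,\tilde f)$, where $$\Omega_+=\begin{pmatrix}1&\delta^{\top}\\ \delta&\Omega\end{pmatrix}$$ is positive definite with all diagonal elements equal to $1$, and let $Z=(U_1\mid U_0>0)$. Assume that $U$ is c-unimodal. If $\tilde f$ is log-concave, then the elliptical densities of $U$ and $U_1$ and the skew-elliptical density of $Z$ are log-concave. Moreover they are strictly log-concave if $U$ is unimodal or $\tilde f$ is strictly log-concave or the support of $\tilde f$ is bounded.
   Context: A $d$-dimensional random variable has an elliptical density with density generator $\tilde f$, written $\mathcal{E}_d(0,\Omega,\tilde f)$, if its density is $y\mapsto k\,\tilde f(y^{\top}\Omega^{-1}y)$, where $\Omega$ is a $d\times d$ positive definite matrix, $\tilde f:(0,+\infty)\to\mathbb{R}^+$ (non-negative values) is such that $x^{d/2-1}\tilde f(x)$ has finite integral on $(0,+\infty)$, and $k$ is a normalizing constant. The skew-elliptical variable $Z=(U_1\mid U_0>0)$ has the conditional distribution of $U_1$ given $U_0>0$; its density is $f_Z(u_1)=2\int_0^{+\infty}k_1\tilde f(u^{\top}\Omega_+^{-1}u)\,du_0$ with $u^{\top}=(u_0,u_1^{\top})$ and $k_1$ the normalizing constant of the density of $U$. A mode of a density is a point where it takes a maximum value, locally or globally. A density (or a random variable having it) is c-unimodal if the set of its modes is convex, and unimodal if its mode is unique; an elliptical density is c-unimodal if and only if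 its generator $\tilde f$ is non-increasing, and unimodal if and only if $\tilde f$ is decreasing. A function $f$ on a convex set $S$ is log-concave if $f(\theta x+(1-\theta)y)\ge f(x)^{\theta}f(y)^{1-\theta}$ for all $x,y\in S$ and $\theta\in(0,1)$; it is strictly log-concave if the inequality is strict for all $x\ne y$ and all $\theta$. Concavity properties of a density are understood on its support.
   Formalization: Bounded support of the generator is asserted to give strict log-concavity only for the densities of U_1 and Z, not of U: for a generator equal to 1 on (0,1) and 0 beyond, U is uniform on an ellipsoid and its density is not strictly log-concave. *)

theory Defs
  imports "HOL-Probability.Probability"
begin

definition pos_def_matrix :: "real^'m^'m \<Rightarrow> bool" where
  "pos_def_matrix A \<longleftrightarrow> transpose A = A \<and> (\<forall>x. x \<noteq> 0 \<longrightarrow> 0 < x \<bullet> (A *v x))"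

subsection \<open>Log-concavity\<close>

definition log_concave_on :: "'a::real_vector set \<Rightarrow> ('a \<Rightarrow> real) \<Rightarrow> bool" where
  "log_concave_on S f \<longleftrightarrow> convex S \<and>
     (\<forall>x\<in>S. \<forall>y\<in>S. \<forall>\<theta>. 0 < \<theta> \<and> \<theta> < 1 \<longrightarrow>
        f (\<theta> *\<^sub>R x + (1 - \<theta>) *\<^sub>R y) \<ge> f x powr \<theta> * f y powr (1 - \<theta>))"

definition strictly_log_concave_on :: "'a::real_vector set \<Rightarrow> ('a \<Rightarrow> real) \<Rightarrow> bool" where
  "strictly_log_concave_on S f \<longleftrightarrow> convex S \<and>
     (\<forall>x\<in>S. \<forall>y\<in>S. \<forall>\<theta>. x \<noteq> y \<and> 0 < \<theta> \<and> \<theta> < 1 \<longrightarrow>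
        f (\<theta> *\<^sub>R x + (1 - \<theta>) *\<^sub>R y) > f x powr \<theta> * f y powr (1 - \<theta>))"

text \<open>Concavity properties of a density are understood on its support.\<close>

definition support :: "('a \<Rightarrow> real) \<Rightarrow> 'a set" where
  "support p = {x. 0 < p x}"

definition log_concave_density :: "('a::real_vector \<Rightarrow> real) \<Rightarrow> bool" where
  "log_concave_density p \<longleftrightarrow> log_concave_on (support p) p"

definition strictly_log_concave_density :: "('a::real_vector \<Rightarrow> real) \<Rightarrow> bool" where
  "strictly_log_concave_density p \<longleftrightarrow> strictly_log_concave_on (support p) p"

subsection \<open>Modes\<close>

text \<open>
  A mode is a local (in particular, possibly global) maximum point in the support: without the
  restriction to the support, every point at which a density vanishes identically nearby would
  count as a mode, and no density with bounded support could be c-unimodal.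
  A c-unimodal density is required to have a mode at all, so that the empty set of modes
  is not accepted as a convex one; otherwise the generator exp on (0,1), zero on [1,\<open>\<infinity>\<close>), would be
  c-unimodal although it is not non-increasing.
\<close>

definition is_mode :: "('a::topological_space \<Rightarrow> real) \<Rightarrow> 'a \<Rightarrow> bool" where
  "is_mode p x \<longleftrightarrow> x \<in> support p \<and> (\<forall>\<^sub>F y in nhds x. p y \<le> p x)"

definition c_unimodal :: "('a::real_normed_vector \<Rightarrow> real) \<Rightarrow> bool" where
  "c_unimodal p \<longleftrightarrow> {x. is_mode p x} \<noteq> {} \<and> convex {x. is_mode p x}"

definition unimodal :: "('a::topological_space \<Rightarrow> real) \<Rightarrow> bool" where
  "unimodal p \<longleftrightarrow> (\<exists>!x. is_mode p x)"

subsection \<open>Elliptical densities\<close>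

text \<open>
  A generator is a function on (0,\<open>\<infinity>\<close>); it is represented by a total function whose values outside
  (0,\<open>\<infinity>\<close>) are never used. The formula for the density then says nothing at the origin,
  where the quadratic form vanishes; the density is extended there by the right limit
  of the generator at 0.
\<close>

definition generator_support :: "(real \<Rightarrow> real) \<Rightarrow> real set" where
  "generator_support f = {x. 0 < x \<and> 0 < f x}"

definition generator_ext :: "(real \<Rightarrow> real) \<Rightarrow> real \<Rightarrow> real" where
  "generator_ext f t = (if 0 < t then f t else Lim (at_right 0) f)"

definition density_generator :: "nat \<Rightarrow> (real \<Rightarrow> real) \<Rightarrow> bool" where
  "density_generator d f \<longleftrightarrow> (\<forall>x>0. 0 \<le> f x) \<and>
     set_integrable lborel {0<..} (\<lambda>x. x powr (real d / 2 - 1) * f x)"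

definition elliptical_kernel :: "real^'m^'m \<Rightarrow> (real \<Rightarrow> real) \<Rightarrow> real^'m \<Rightarrow> real" where
  "elliptical_kernel \<Omega> f y = generator_ext f (y \<bullet> (matrix_inv \<Omega> *v y))"

definition elliptical_density :: "real^'m^'m \<Rightarrow> (real \<Rightarrow> real) \<Rightarrow> real^'m \<Rightarrow> real" where
  "elliptical_density \<Omega> f y =
     (1 / (LINT x|lborel. elliptical_kernel \<Omega> f x)) * elliptical_kernel \<Omega> f y"

definition has_elliptical_density ::
    "'s measure \<Rightarrow> ('s \<Rightarrow> real^'m) \<Rightarrow> real^'m^'m \<Rightarrow> (real \<Rightarrow> real) \<Rightarrow> bool" where
  "has_elliptical_density M X \<Omega> f \<longleftrightarrow>
     pos_def_matrix \<Omega> \<and> density_generator CARD('m) f \<and>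
     distributed M lborel X (\<lambda>y. ennreal (elliptical_density \<Omega> f y))"

subsection \<open>Skew-elliptical densities\<close>

text \<open>
  The index type \<open>'n option\<close> has one element more than \<open>'n\<close>; the index \<open>None\<close> is the coordinate
  numbered 0, and the indices \<open>Some j\<close> are the remaining ones.
\<close>

definition vec_join :: "real \<Rightarrow> real^'n \<Rightarrow> real^('n::finite option)" where
  "vec_join u0 u1 = (\<chi> i. case i of None \<Rightarrow> u0 | Some j \<Rightarrow> u1 $ j)"

definition vec_head :: "real^('n::finite option) \<Rightarrow> real" where
  "vec_head u = u $ None"

definition vec_tail :: "real^('n::finite option) \<Rightarrow> real^'n" where
  "vec_tail u = (\<chi> j. u $ Some j)"

definition Omega_plus :: "real^'n \<Rightarrow> real^'n^'n \<Rightarrow> real^('n::finite option)^('n option)" where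
  "Omega_plus \<delta> \<Omega> = (\<chi> i. case i of None \<Rightarrow> vec_join 1 \<delta> | Some j \<Rightarrow> vec_join (\<delta> $ j) (\<Omega> $ j))"

text \<open>
  The density of \<open>U\<^sub>1\<close> is the marginal of the density of \<open>U\<close>, and
  the density of \<open>Z = (U\<^sub>1 | U\<^sub>0 > 0)\<close> is given by \<open>2 \<integral>\<^sub>0\<^sup>\<infinity> k\<^sub>1 f(u\<^sup>T \<Omega>\<^sub>+\<^sup>-\<^sup>1 u) du\<^sub>0\<close>.
\<close>

definition marginal_density :: "real^'n \<Rightarrow> real^'n^'n \<Rightarrow> (real \<Rightarrow> real) \<Rightarrow> real^'n \<Rightarrow> real" where
  "marginal_density \<delta> \<Omega> f u1 =
     (LINT u0|lborel. elliptical_density (Omega_plus \<delta> \<Omega>) f (vec_join u0 u1))"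

definition skew_elliptical_density ::
    "real^'n \<Rightarrow> real^'n^'n \<Rightarrow> (real \<Rightarrow> real) \<Rightarrow> real^'n \<Rightarrow> real" where
  "skew_elliptical_density \<delta> \<Omega> f u1 =
     2 * (LINT u0:{0<..}|lborel. elliptical_density (Omega_plus \<delta> \<Omega>) f (vec_join u0 u1))"

end

theory Submission
  imports Defs
begin

text \<open>
  The density of \<open>U\<close> is even, so its set of modes is symmetric; being convex and nonempty it contains
  the origin. A log-concave generator rises and then falls, and a local maximum at the origin leaves only
  the possibility that it is non-increasing and has a positive right limit at 0
  (locale \<open>peaked_generator\<close>). Hence the
  density of \<open>U\<close> is a constant multiple of \<open>g (quad_form W y)\<close>, where \<open>g\<close> is a non-increasing
  log-concave function on the closed half-line which tends to 0 (locale \<open>log_concave_profile\<close>)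
  and \<open>W\<close> is the inverse of \<open>\<Omega>\<^sub>+\<close>.

  Since \<open>quad_form W\<close> is strictly convex, \<open>g \<circ> quad_form W\<close> is log-concave, strictly so as soon as \<open>g\<close>
  decreases strictly on its support. Log-concavity makes a plateau of \<open>g\<close> start at 0, and such
  a plateau is excluded both by uniqueness of the mode (every point of the plateau would be a mode) and
  by strict log-concavity of the generator.

  The densities of \<open>U\<^sub>1\<close> and \<open>Z\<close> are integrals of this function over the fibers \<open>u\<^sub>0 \<in> D\<close>, with \<open>D\<close> the
  line or the positive half-line. For fibers over \<open>x \<noteq> y\<close> the superlevel sets are bounded intervals, and the
  superlevel set over \<open>\<theta>x + (1-\<theta>)y\<close> contains the Minkowski combination of the two others. The
  identity \<open>quad_form_convex_combination\<close> gives more: the quadratic form drops below the convex combination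
  of its values by an amount that is bounded below uniformly on the fibers, so the superlevel set reaches
  beyond the right end of the Minkowski combination
  (\<open>fiber_superlevel_strict_brunn_minkowski\<close>). This yields a strict inequality of lengths at every level,
  also where \<open>g\<close> is constant. Integrating the lengths over the levels and applying the weighted
  inequality of arithmetic and geometric means gives strict log-concavity of both fiber integrals
  (\<open>strict_prekopa_leindler\<close>, \<open>strictly_log_concave_fiber_integral\<close>).

  That the fiber integrals are the densities of \<open>U\<^sub>1\<close> and \<open>Z\<close> is Tonelli's theorem in the
  coordinates \<open>vec_join\<close>. The factor 2 is \<open>1 / P (U\<^sub>0 > 0)\<close>: the law of \<open>U\<close> is symmetric and the
  hyperplane \<open>u\<^sub>0 = 0\<close> is a null set.
\<close>

section \<open>Log-concave functions\<close>

lemma log_concave_onD: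
  "log_concave_on S f \<Longrightarrow> x \<in> S \<Longrightarrow> y \<in> S \<Longrightarrow> 0 < \<theta> \<Longrightarrow> \<theta> < 1 \<Longrightarrow>
    f x powr \<theta> * f y powr (1 - \<theta>) \<le> f (\<theta> *\<^sub>R x + (1 - \<theta>) *\<^sub>R y)"
  by (simp add: log_concave_on_def)

lemma strictly_log_concave_onD:
  "strictly_log_concave_on S f \<Longrightarrow> x \<in> S \<Longrightarrow> y \<in> S \<Longrightarrow> x \<noteq> y \<Longrightarrow> 0 < \<theta> \<Longrightarrow> \<theta> < 1 \<Longrightarrow>
    f x powr \<theta> * f y powr (1 - \<theta>) < f (\<theta> *\<^sub>R x + (1 - \<theta>) *\<^sub>R y)"
  by (simp add: strictly_log_concave_on_def)

lemma log_concave_on_scale: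
  assumes "0 < c" "log_concave_on S p"
  shows "log_concave_on S (\<lambda>x. c * p x)"
  unfolding log_concave_on_def
proof (intro conjI ballI allI impI)
  show "convex S" using assms by (simp add: log_concave_on_def)
  fix x y \<theta> assume *: "x \<in> S" "y \<in> S" "0 < \<theta> \<and> \<theta> < (1::real)"
  have "(c * p x) powr \<theta> * (c * p y) powr (1 - \<theta>)
      = (c powr \<theta> * c powr (1 - \<theta>)) * (p x powr \<theta> * p y powr (1 - \<theta>))"
    by (simp add: powr_mult)
  also have "c powr \<theta> * c powr (1 - \<theta>) = c" using assms(1) by (simp add: powr_add[symmetric])
  finally show "(c * p x) powr \<theta> * (c * p y) powr (1 - \<theta>) \<le> c * p (\<theta> *\<^sub>R x + (1 - \<theta>) *\<^sub>R y)"
    using assms * by (simp add: log_concave_on_def)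
qed

lemma strictly_log_concave_on_scale:
  assumes "0 < c" "strictly_log_concave_on S p"
  shows "strictly_log_concave_on S (\<lambda>x. c * p x)"
  unfolding strictly_log_concave_on_def
proof (intro conjI ballI allI impI)
  show "convex S" using assms by (simp add: strictly_log_concave_on_def)
  fix x y \<theta> assume *: "x \<in> S" "y \<in> S" "x \<noteq> y \<and> 0 < \<theta> \<and> \<theta> < (1::real)"
  have "(c * p x) powr \<theta> * (c * p y) powr (1 - \<theta>)
      = (c powr \<theta> * c powr (1 - \<theta>)) * (p x powr \<theta> * p y powr (1 - \<theta>))"
    by (simp add: powr_mult)
  also have "c powr \<theta> * c powr (1 - \<theta>) = c" using assms(1) by (simp add: powr_add[symmetric])
  finally show "(c * p x) powr \<theta> * (c * p y) powr (1 - \<theta>) < c * p (\<theta> *\<^sub>R x + (1 - \<theta>) *\<^sub>R y)"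
    using assms * by (simp add: strictly_log_concave_on_def)
qed

lemma support_scale: "0 < c \<Longrightarrow> support (\<lambda>x. c * p x) = support p"
  by (auto simp: support_def zero_less_mult_iff)

lemma log_concave_density_scale:
  "0 < c \<Longrightarrow> log_concave_density p \<Longrightarrow> log_concave_density (\<lambda>x. c * p x)"
  by (simp add: log_concave_density_def support_scale log_concave_on_scale)

lemma strictly_log_concave_density_scale:
  "0 < c \<Longrightarrow> strictly_log_concave_density p \<Longrightarrow> strictly_log_concave_density (\<lambda>x. c * p x)"
  by (simp add: strictly_log_concave_density_def support_scale strictly_log_concave_on_scale)

lemma strictly_log_concave_imp_log_concave:
  assumes "strictly_log_concave_density p"
  shows "log_concave_density p"
  unfolding log_concave_density_def log_concave_on_def
proof (intro conjI ballI allI impI)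
  show "convex (support p)"
    using assms by (simp add: strictly_log_concave_density_def strictly_log_concave_on_def)
  fix x y \<theta> assume *: "x \<in> support p" "y \<in> support p" "0 < \<theta> \<and> \<theta> < (1::real)"
  show "p x powr \<theta> * p y powr (1 - \<theta>) \<le> p (\<theta> *\<^sub>R x + (1 - \<theta>) *\<^sub>R y)"
  proof (cases "x = y")
    case True
    then show ?thesis using * by (simp add: powr_add[symmetric] scaleR_left_distrib[symmetric] support_def)
  next
    case False
    then show ?thesis
      using assms * by (auto simp: strictly_log_concave_density_def strictly_log_concave_on_def intro: less_imp_le)
  qed
qed

text \<open>
  The strict inequality alone makes the support convex, because its right-hand side exceeds a
  non-negative number.
\<close>

lemma strictly_log_concave_densityI:
  assumes "\<And>x y \<theta>. 0 < p x \<Longrightarrow> 0 < p y \<Longrightarrow> x \<noteq> y \<Longrightarrow> 0 < \<theta> \<Longrightarrow> \<theta> < 1 \<Longrightarrow>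
    p x powr \<theta> * p y powr (1 - \<theta>) < p (\<theta> *\<^sub>R x + (1 - \<theta>) *\<^sub>R y)"
  shows "strictly_log_concave_density p"
proof -
  have "u *\<^sub>R x + v *\<^sub>R y \<in> support p"
    if xy: "x \<in> support p" "y \<in> support p" and uv: "0 \<le> u" "0 \<le> v" "u + v = 1" for x y u v
  proof -
    consider "x = y" | "u = 0" | "v = 0" | "x \<noteq> y" "0 < u" "0 < v" using uv by force
    then show ?thesis
    proof cases
      case 4
      have "0 \<le> p x powr u * p y powr (1 - u)" by simp
      also have "\<dots> < p (u *\<^sub>R x + (1 - u) *\<^sub>R y)"
        using xy uv 4 by (intro assms) (auto simp: support_def)
      also have "1 - u = v" using uv by simp
      finally show ?thesis by (simp add: support_def)
    qed (use xy uv in \<open>auto simp: scaleR_left_distrib[symmetric]\<close>)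
  qed
  then have "convex (support p)" by (rule convexI)
  then show ?thesis
    unfolding strictly_log_concave_density_def strictly_log_concave_on_def
    using assms by (auto simp: support_def)
qed

section \<open>A strict Prekopa-Leindler inequality on the line\<close>

text \<open>
  Both sides are the area under the graph of \<open>A\<close>, sliced in the two directions. The level
  \<open>t\<close> is restricted to the positive half-line, where integrability makes the superlevel sets
  have finite length.
\<close>

lemma layer_cake:
  fixes A :: "real \<Rightarrow> real"
  assumes int: "integrable lborel A" and nonneg: "\<And>s. 0 \<le> A s"
  shows "has_bochner_integral lborel
           (\<lambda>t. indicator {0<..} t * measure lborel {s. t < A s}) (LINT s|lborel. A s)"
proof (rule has_bochner_integral_nn_integral)
  have [measurable]: "A \<in> borel_measurable borel"
    using int by (simp add: borel_measurable_integrable)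
  have fin: "emeasure lborel {s. t < A s} < \<infinity>" if "0 < t" for t
  proof -
    have "emeasure lborel {s. t < A s} \<le> emeasure lborel {s \<in> space lborel. 1 \<le> ennreal (1/t) * ennreal (A s)}"
      using that by (intro emeasure_mono) (auto simp: ennreal_mult'[symmetric] nonneg ennreal_1[symmetric] simp del: ennreal_1)
    also have "\<dots> \<le> ennreal (1/t) * (\<integral>\<^sup>+s. ennreal (A s) * indicator UNIV s \<partial>lborel)"
      using nn_integral_Markov_inequality[of "\<lambda>s. ennreal (A s)" UNIV lborel "ennreal (1/t)"] by simp
    also have "\<dots> < \<infinity>"
      using int nonneg by (auto simp: nn_integral_eq_integral ennreal_mult_less_top)
    finally show ?thesis .
  qed
  show "(\<lambda>t. indicator {0<..} t * measure lborel {s. t < A s}) \<in> borel_measurable lborel"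
  proof -
    have "(\<lambda>t. emeasure lborel (Pair t -` {x \<in> space (borel \<Otimes>\<^sub>M borel). fst x < A (snd x)})) \<in> borel_measurable borel"
      by (intro lborel.measurable_emeasure_Pair) measurable
    then have "(\<lambda>t. measure lborel {s. t < A s}) \<in> borel_measurable borel"
      by (simp add: measure_def space_pair_measure vimage_def)
    then show ?thesis by simp
  qed
  show "AE t in lborel. 0 \<le> indicator {0<..} t * measure lborel {s. t < A s}" by simp
  show "0 \<le> (LINT s|lborel. A s)" by (simp add: nonneg)
  have "(\<integral>\<^sup>+t. ennreal (indicator {0<..} t * measure lborel {s. t < A s}) \<partial>lborel)
      = (\<integral>\<^sup>+t. (\<integral>\<^sup>+s. indicator {x. 0 < fst x \<and> fst x < A (snd x)} (t, s) \<partial>lborel) \<partial>lborel)"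
  proof (intro nn_integral_cong)
    fix t :: real
    show "ennreal (indicator {0<..} t * measure lborel {s. t < A s})
        = (\<integral>\<^sup>+s. indicator {x. 0 < fst x \<and> fst x < A (snd x)} (t, s) \<partial>lborel)"
    proof (cases "0 < t")
      case True
      then have "(\<integral>\<^sup>+s. indicator {x. 0 < fst x \<and> fst x < A (snd x)} (t, s) \<partial>lborel)
          = (\<integral>\<^sup>+s. indicator {s. t < A s} s \<partial>lborel)"
        by (intro nn_integral_cong) (simp split: split_indicator)
      also have "\<dots> = emeasure lborel {s. t < A s}" by (subst nn_integral_indicator) auto
      finally show ?thesis using fin[OF True] True by (simp add: emeasure_eq_ennreal_measure)
    qed (simp split: split_indicator)
  qed
  also have "\<dots> = (\<integral>\<^sup>+s. (\<integral>\<^sup>+t. indicator {x. 0 < fst x \<and> fst x < A (snd x)} (t, s) \<partial>lborel) \<partial>lborel)"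
    by (rule lborel_pair.Fubini'[symmetric]) measurable
  also have "\<dots> = (\<integral>\<^sup>+s. ennreal (A s) \<partial>lborel)"
  proof (intro nn_integral_cong)
    fix s :: real
    have "(\<integral>\<^sup>+t. indicator {x. 0 < fst x \<and> fst x < A (snd x)} (t, s) \<partial>lborel)
        = (\<integral>\<^sup>+t. indicator {0<..<A s} t \<partial>lborel)"
      by (intro nn_integral_cong) (simp split: split_indicator)
    also have "\<dots> = ennreal (A s)" using nonneg[of s] by simp
    finally show "(\<integral>\<^sup>+t. indicator {x. 0 < fst x \<and> fst x < A (snd x)} (t, s) \<partial>lborel) = ennreal (A s)" .
  qed
  also have "\<dots> = ennreal (LINT s|lborel. A s)"
    using int nonneg by (simp add: nn_integral_eq_integral)
  finally show "(\<integral>\<^sup>+t. ennreal (indicator {0<..} t * measure lborel {s. t < A s}) \<partial>lborel)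
      = ennreal (LINT s|lborel. A s)" .
qed

text \<open>
  From level 1 on the superlevel sets of \<open>A\<close> and \<open>B\<close> are empty, so the strict inequality of lengths is only
  asked for at lower levels. Integrated over the levels it becomes an inequality of integrals.
\<close>

lemma strict_arithmetic_prekopa_leindler:
  fixes A B C :: "real \<Rightarrow> real"
  assumes int: "integrable lborel A" "integrable lborel B" "integrable lborel C"
    and nonneg: "\<And>s. 0 \<le> A s" "\<And>s. 0 \<le> B s" "\<And>s. 0 \<le> C s"
    and le1: "\<And>s. A s \<le> 1" "\<And>s. B s \<le> 1"
    and level: "\<And>t. 0 < t \<Longrightarrow> t < 1 \<Longrightarrow>
      \<theta> * measure lborel {s. t < A s} + (1 - \<theta>) * measure lborel {s. t < B s}
        < measure lborel {s. t < C s}"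
  shows "\<theta> * (LINT s|lborel. A s) + (1 - \<theta>) * (LINT s|lborel. B s) < (LINT s|lborel. C s)"
proof -
  define m where "m F t = indicator {0<..} t * measure lborel {s. t < F s}" for F :: "real \<Rightarrow> real" and t :: real
  have m: "integrable lborel (m F)" "(LINT t|lborel. m F t) = (LINT s|lborel. F s)"
    if "integrable lborel F" "\<And>s. 0 \<le> F s" for F
    using layer_cake[OF that] by (simp_all add: m_def[abs_def] has_bochner_integral_iff)
  \<comment> \<open>The integrand \<open>D\<close> is non-negative everywhere and positive on \<open>(0, 1)\<close>, so its integral is positive.\<close>
  define D where "D t = m C t - (\<theta> * m A t + (1 - \<theta>) * m B t)" for t
  have D_int: "integrable lborel D"
    unfolding D_def by (intro Bochner_Integration.integrable_diff Bochner_Integration.integrable_add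
        integrable_mult_right m int nonneg)
  have D_eq: "(LINT t|lborel. D t)
      = (LINT s|lborel. C s) - (\<theta> * (LINT s|lborel. A s) + (1 - \<theta>) * (LINT s|lborel. B s))"
    unfolding D_def by (simp add: m int nonneg)
  have D_pos: "0 < D t" if "0 < t" "t < 1" for t
    using level[OF that] that by (simp add: D_def m_def)
  have D_nonneg: "0 \<le> D t" for t
  proof (cases "0 < t \<and> t < 1")
    case True then show ?thesis using D_pos by (simp add: less_imp_le)
  next
    case False
    have "{s. t < A s} = {}" "{s. t < B s} = {}" if "1 \<le> t"
      using le1 that by (auto simp: not_less intro: order_trans)
    then show ?thesis using False
      by (auto simp: D_def m_def split: split_indicator)
  qed
  have "(LINT t|lborel. D t) \<noteq> 0"
  proof
    assume "(LINT t|lborel. D t) = 0"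
    then have "AE t in lborel. D t = 0"
      using integral_nonneg_eq_0_iff_AE[OF D_int] D_nonneg by simp
    then have "AE t in lborel. t \<notin> {0<..<1::real}"
      by eventually_elim (use D_pos in force)
    then have "emeasure lborel {0<..<1::real} = 0"
      by (subst (asm) AE_iff_measurable[where N="{0<..<1}"]) auto
    then show False by simp
  qed
  moreover have "0 \<le> (LINT t|lborel. D t)" using D_nonneg by simp
  ultimately show ?thesis using D_eq by linarith
qed

lemma superlevel_scale:
  fixes F :: "'a \<Rightarrow> real"
  assumes "0 < c"
  shows "{s. t < F s / c} = {s. t * c < F s}"
  using assms by (simp add: pos_less_divide_eq)

text \<open>
  Dividing \<open>A\<close> and \<open>B\<close> by their suprema \<open>a\<close> and \<open>b\<close>, and \<open>C\<close> by \<open>a powr \<theta> * b powr (1 - \<theta>)\<close>, matches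
  the levels of the three functions, so that the arithmetic form applies. The inequality of arithmetic and
  geometric means then turns the arithmetic mean into the geometric one. The hypothesis on the superlevel
  sets is a strict one-dimensional Brunn-Minkowski inequality.
\<close>

lemma strict_prekopa_leindler:
  fixes A B C :: "real \<Rightarrow> real"
  assumes \<theta>: "0 < \<theta>" "\<theta> < 1"
    and int: "integrable lborel A" "integrable lborel B" "integrable lborel C"
    and nonneg: "\<And>s. 0 \<le> A s" "\<And>s. 0 \<le> B s" "\<And>s. 0 \<le> C s"
    and bdd: "bdd_above (range A)" "bdd_above (range B)"
    and pos: "0 < (LINT s|lborel. A s)" "0 < (LINT s|lborel. B s)"
    and level: "\<And>\<mu> \<nu>. 0 < \<mu> \<Longrightarrow> 0 < \<nu> \<Longrightarrow> {s. \<mu> < A s} \<noteq> {} \<Longrightarrow> {s. \<nu> < B s} \<noteq> {} \<Longrightarrow>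
      \<theta> * measure lborel {s. \<mu> < A s} + (1 - \<theta>) * measure lborel {s. \<nu> < B s}
        < measure lborel {s. \<mu> powr \<theta> * \<nu> powr (1 - \<theta>) < C s}"
  shows "(LINT s|lborel. A s) powr \<theta> * (LINT s|lborel. B s) powr (1 - \<theta>) < (LINT s|lborel. C s)"
proof -
  define a where "a = (SUP s. A s)"
  define b where "b = (SUP s. B s)"
  define c where "c = a powr \<theta> * b powr (1 - \<theta>)"
  have Sup_pos: "0 < (SUP s. F s)"
    if F: "bdd_above (range F)" "\<And>s. 0 \<le> F s" "0 < (LINT s|lborel. F s)" for F :: "real \<Rightarrow> real"
  proof -
    have "\<exists>s. 0 < F s"
    proof (rule ccontr)
      assume "\<nexists>s. 0 < F s"
      then have "F = (\<lambda>s. 0)" using F(2) by (auto simp: fun_eq_iff not_less intro: antisym)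
      then show False using F(3) by simp
    qed
    then show ?thesis using F(1) by (metis cSUP_upper UNIV_I less_le_trans)
  qed
  have ab: "0 < a" "0 < b" using Sup_pos bdd nonneg pos by (auto simp: a_def b_def)
  then have c: "0 < c" by (simp add: c_def)
  have upper: "A s \<le> a" "B s \<le> b" for s
    using bdd by (auto simp: a_def b_def intro: cSUP_upper)
  have "\<theta> * (LINT s|lborel. A s / a) + (1 - \<theta>) * (LINT s|lborel. B s / b) < (LINT s|lborel. C s / c)"
  proof (rule strict_arithmetic_prekopa_leindler)
    fix t :: real assume t: "0 < t" "t < 1"
    have "t * a < a" "t * b < b" using t ab by auto
    then have "{s. t * a < A s} \<noteq> {}" "{s. t * b < B s} \<noteq> {}"
      using less_cSUP_iff[OF _ bdd(1)] less_cSUP_iff[OF _ bdd(2)] by (auto simp: a_def b_def)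
    then have "\<theta> * measure lborel {s. t * a < A s} + (1 - \<theta>) * measure lborel {s. t * b < B s}
        < measure lborel {s. (t * a) powr \<theta> * (t * b) powr (1 - \<theta>) < C s}"
      using t ab by (intro level) auto
    moreover have "(t * a) powr \<theta> * (t * b) powr (1 - \<theta>) = t * c"
    proof -
      have "(t * a) powr \<theta> * (t * b) powr (1 - \<theta>) = (t powr \<theta> * t powr (1 - \<theta>)) * c"
        using t ab by (simp add: powr_mult c_def)
      also have "t powr \<theta> * t powr (1 - \<theta>) = t" using t by (simp add: powr_add[symmetric])
      finally show ?thesis .
    qed
    ultimately show "\<theta> * measure lborel {s. t < A s / a} + (1 - \<theta>) * measure lborel {s. t < B s / b}
        < measure lborel {s. t < C s / c}"
      using ab c by (simp add: superlevel_scale)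
  qed (use int nonneg ab c upper in auto)
  then have less: "\<theta> * ((LINT s|lborel. A s) / a) + (1 - \<theta>) * ((LINT s|lborel. B s) / b) < (LINT s|lborel. C s) / c"
    by simp
  have "((LINT s|lborel. A s) / a) powr \<theta> * ((LINT s|lborel. B s) / b) powr (1 - \<theta>)
      \<le> \<theta> * ((LINT s|lborel. A s) / a) + (1 - \<theta>) * ((LINT s|lborel. B s) / b)"
    using \<theta> pos ab by (intro Youngs_inequality_0) auto
  moreover have "((LINT s|lborel. A s) / a) powr \<theta> * ((LINT s|lborel. B s) / b) powr (1 - \<theta>)
      = (LINT s|lborel. A s) powr \<theta> * (LINT s|lborel. B s) powr (1 - \<theta>) / c"
    using pos ab by (simp add: powr_divide c_def)
  ultimately have "(LINT s|lborel. A s) powr \<theta> * (LINT s|lborel. B s) powr (1 - \<theta>) / c < (LINT s|lborel. C s) / c"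
    using less by linarith
  then show ?thesis using c by (simp add: divide_less_cancel)
qed

section \<open>Positive definite quadratic forms\<close>

definition quad_form :: "real^'m^'m \<Rightarrow> real^'m \<Rightarrow> real" where
  "quad_form W y = y \<bullet> (W *v y)"

lemma continuous_quad_form: "continuous_on S (quad_form W)"
  unfolding quad_form_def[abs_def]
  by (intro continuous_intros linear_continuous_on linear_conv_bounded_linear[THEN iffD1] matrix_vector_mul_linear)

lemma quad_form_scaleR: "quad_form W (c *\<^sub>R y) = c\<^sup>2 * quad_form W y"
  by (simp add: quad_form_def matrix_vector_mult_scaleR power2_eq_square)

lemma quad_form_uminus: "quad_form W (- y) = quad_form W y"
  using quad_form_scaleR[of W "-1" y] by simp

lemma quad_form_0: "quad_form W 0 = 0"
  by (simp add: quad_form_def)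

text \<open>
  The last term is the exact gain over convexity. It depends on the two points only through their
  difference, which is what makes the gain uniform along fibers.
\<close>

lemma quad_form_convex_combination:
  "quad_form W (\<theta> *\<^sub>R x + (1 - \<theta>) *\<^sub>R y)
    = \<theta> * quad_form W x + (1 - \<theta>) * quad_form W y - \<theta> * (1 - \<theta>) * quad_form W (x - y)"
  by (simp add: quad_form_def matrix_vector_mult_scaleR matrix_vector_right_distrib
      matrix_vector_mult_diff_distrib inner_simps algebra_simps power2_eq_square)

locale positive_quad_form =
  fixes W :: "real^'m^'m"
  assumes quad_form_pos: "y \<noteq> 0 \<Longrightarrow> 0 < quad_form W y"
begin

lemma quad_form_nonneg: "0 \<le> quad_form W y"
  by (cases "y = 0") (simp_all add: quad_form_0 quad_form_pos less_imp_le)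

lemma quad_form_strictly_convex:
  assumes "x \<noteq> y" "0 < \<theta>" "\<theta> < 1"
  shows "quad_form W (\<theta> *\<^sub>R x + (1 - \<theta>) *\<^sub>R y) < \<theta> * quad_form W x + (1 - \<theta>) * quad_form W y"
  using assms quad_form_pos[of "x - y"] by (simp add: quad_form_convex_combination)

text \<open>
  The constant is the minimum of the form on the unit sphere.
\<close>

lemma quad_form_coercive:
  obtains c where "0 < c" "\<And>y. c * (norm y)\<^sup>2 \<le> quad_form W y"
proof -
  obtain z where z: "z \<in> sphere 0 1" "\<And>y. y \<in> sphere 0 1 \<Longrightarrow> quad_form W z \<le> quad_form W y"
    using continuous_attains_inf[OF compact_sphere _ continuous_quad_form, of "0 :: real^'m" 1 W] by auto
  have "quad_form W z * (norm y)\<^sup>2 \<le> quad_form W y" for y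
  proof (cases "y = 0")
    case False
    have "quad_form W z \<le> quad_form W (y /\<^sub>R norm y)" using False by (intro z(2)) simp
    also have "\<dots> = quad_form W y / (norm y)\<^sup>2"
      by (simp add: quad_form_scaleR power_inverse divide_inverse mult.commute)
    finally show ?thesis using False by (simp add: pos_le_divide_eq)
  qed (simp add: quad_form_0)
  moreover have "0 < quad_form W z" using z(1) by (intro quad_form_pos) auto
  ultimately show ?thesis using that by blast
qed

end

lemma (in positive_quad_form) quad_form_attains:
  assumes "0 < s"
  obtains y where "y \<noteq> 0" "quad_form W y = s"
proof -
  define v :: "real^'m" where "v = axis undefined 1"
  have v: "0 < quad_form W v" by (rule quad_form_pos) (simp add: v_def axis_eq_0_iff)
  show ?thesis
  proof
    have "v \<noteq> 0" by (simp add: v_def axis_eq_0_iff)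
    then show "sqrt (s / quad_form W v) *\<^sub>R v \<noteq> 0" using v assms by simp
    show "quad_form W (sqrt (s / quad_form W v) *\<^sub>R v) = s"
      using v assms by (simp add: quad_form_scaleR)
  qed
qed

text \<open>
  With \<open>y = A *v v\<close> the form of the inverse at \<open>y\<close> is the form of \<open>A\<close> at \<open>v\<close>.
\<close>

lemma pos_def_matrix_imp_positive_quad_form_inv:
  fixes A :: "real^'m^'m"
  assumes "pos_def_matrix A"
  shows "positive_quad_form (matrix_inv A)"
proof
  fix y :: "real^'m" assume y: "y \<noteq> 0"
  have "x = 0" if "A *v x = 0" for x
    using assms that unfolding pos_def_matrix_def by force
  then have "invertible A"
    by (metis invertible_left_inverse matrix_left_invertible_ker)
  then have inv: "A ** matrix_inv A = mat 1"
    unfolding invertible_def matrix_inv_def by (metis (mono_tags, lifting) someI_ex)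
  define v where "v = matrix_inv A *v y"
  have y_eq: "y = A *v v"
    by (simp add: v_def matrix_vector_mul_assoc inv)
  then have "v \<noteq> 0" using y by auto
  then have "0 < v \<bullet> (A *v v)" using assms by (simp add: pos_def_matrix_def)
  then show "0 < quad_form (matrix_inv A) y"
    by (simp add: quad_form_def v_def[symmetric] y_eq[symmetric] inner_commute)
qed

section \<open>Decreasing log-concave profiles\<close>

text \<open>
  The radial part of an elliptical density, as a function of the value of the quadratic form; only
  its restriction to the closed half-line is constrained. In the log-concavity axiom the points with
  \<open>g r = 0\<close> are allowed, since \<open>0 powr \<theta> = 0\<close> makes the inequality trivial there.
\<close>

locale log_concave_profile =
  fixes g :: "real \<Rightarrow> real"
  assumes nonneg: "0 \<le> r \<Longrightarrow> 0 \<le> g r"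
    and pos_at_0: "0 < g 0"
    and decreasing: "0 \<le> r \<Longrightarrow> r \<le> s \<Longrightarrow> g s \<le> g r"
    and log_concave: "0 \<le> r \<Longrightarrow> 0 \<le> s \<Longrightarrow> 0 < \<theta> \<Longrightarrow> \<theta> < 1 \<Longrightarrow>
      g r powr \<theta> * g s powr (1 - \<theta>) \<le> g (\<theta> * r + (1 - \<theta>) * s)"
    and vanishing: "0 < e \<Longrightarrow> \<exists>r\<ge>0. g r < e"
begin

lemma profile_less_imp: "0 \<le> r \<Longrightarrow> 0 \<le> s \<Longrightarrow> g s < g r \<Longrightarrow> r < s"
  using decreasing by (meson leD not_le)

text \<open>
  If \<open>g\<close> has halved at \<open>r1\<close>, then log-concavity between \<open>0\<close>, \<open>r1\<close> and \<open>r\<close> forces it to halve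
  again on each further step of length \<open>r1\<close>. Consequently all fiber integrals converge, and not just
  almost all of them.
\<close>

lemma exponential_tail:
  obtains K c where "0 < K" "0 < c" "\<And>r. 0 \<le> r \<Longrightarrow> g r \<le> K * exp (- c * r)"
proof -
  obtain r1 where r1: "0 \<le> r1" "g r1 < g 0 / 2"
    using vanishing[of "g 0 / 2"] pos_at_0 by auto
  have r1_pos: "0 < r1" using r1 pos_at_0 by (cases "r1 = 0") auto
  have "g r \<le> 2 * g 0 * exp (- (ln 2 / r1) * r)" if r: "0 \<le> r" for r
  proof (cases "r \<le> r1")
    case True
    then have "ln 2 / r1 * r \<le> ln 2" using r1_pos by (simp add: divide_simps)
    then have "exp (- ln 2) \<le> exp (- (ln 2 / r1) * r)" by simp
    moreover have "exp (- ln 2 :: real) = 1 / 2" by (simp add: exp_minus)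
    ultimately have "1 \<le> 2 * exp (- (ln 2 / r1) * r)" by linarith
    then have "g 0 * 1 \<le> g 0 * (2 * exp (- (ln 2 / r1) * r))"
      using pos_at_0 by (intro mult_left_mono) auto
    then show ?thesis using decreasing[of 0 r] r by (simp add: mult_ac)
  next
    case False
    define \<theta> where "\<theta> = r1 / r"
    have \<theta>: "0 < \<theta>" "\<theta> < 1" using False r1_pos by (auto simp: \<theta>_def)
    show ?thesis
    proof (cases "g r = 0")
      case True then show ?thesis using pos_at_0 by simp
    next
      case gr: False
      then have gr: "0 < g r" using nonneg[OF r] by simp
      have "g r powr \<theta> * g 0 powr (1 - \<theta>) \<le> g r1"
        using log_concave[of r 0 \<theta>] r \<theta> False r1_pos by (simp add: \<theta>_def)
      also have "\<dots> \<le> g 0 / 2" using r1 by simp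
      finally have "ln (g r powr \<theta> * g 0 powr (1 - \<theta>)) \<le> ln (g 0 / 2)"
        using gr pos_at_0 by simp
      then have "\<theta> * ln (g r) + (1 - \<theta>) * ln (g 0) \<le> ln (g 0) - ln 2"
        using gr pos_at_0 by (simp add: ln_mult ln_div ln_powr)
      then have "\<theta> * ln (g r) \<le> \<theta> * ln (g 0) - ln 2" by (simp add: algebra_simps)
      then have "ln (g r) \<le> ln (g 0) - ln 2 / \<theta>"
        using \<theta> by (simp add: field_simps)
      then have "exp (ln (g r)) \<le> exp (ln (g 0) - ln 2 / \<theta>)" by (simp only: exp_le_cancel_iff)
      then have "g r \<le> exp (ln (g 0) - ln 2 / \<theta>)" using gr by simp
      also have "\<dots> = g 0 * exp (- (ln 2 / r1) * r)"
        using pos_at_0 by (simp add: exp_diff exp_minus divide_inverse \<theta>_def mult_ac)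
      also have "\<dots> \<le> 2 * g 0 * exp (- (ln 2 / r1) * r)" using pos_at_0 by simp
      finally show ?thesis .
    qed
  qed
  then show ?thesis using that[of "2 * g 0" "ln 2 / r1"] pos_at_0 r1_pos by simp
qed

text \<open>
  Truncation at 0 removes the values of \<open>g\<close> on the negative half-line, about which nothing is known.
\<close>

lemma borel_measurable_truncated: "(\<lambda>r. g (max 0 r)) \<in> borel_measurable borel"
proof -
  have "mono (\<lambda>r. - g (max 0 r))" by (auto simp: mono_def intro!: decreasing)
  then have "(\<lambda>r. - (- g (max 0 r))) \<in> borel_measurable borel"
    by (intro borel_measurable_uminus borel_measurable_mono)
  then show ?thesis by simp
qed

lemma borel_measurable_comp:
  assumes "q \<in> borel_measurable N" "\<And>y. 0 \<le> q y"
  shows "(\<lambda>y. g (q y)) \<in> borel_measurable N"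
proof -
  have "(\<lambda>y. g (max 0 (q y))) \<in> borel_measurable N"
    by (rule measurable_compose[OF assms(1) borel_measurable_truncated])
  then show ?thesis using assms(2) by (simp add: max_def)
qed

lemma log_concave_density_elliptical:
  fixes W :: "real^'m^'m"
  assumes "positive_quad_form W"
  shows "log_concave_density (\<lambda>y. g (quad_form W y))"
proof -
  interpret positive_quad_form W by fact
  have ineq: "g (quad_form W x) powr \<theta> * g (quad_form W y) powr (1 - \<theta>)
      \<le> g (quad_form W (\<theta> *\<^sub>R x + (1 - \<theta>) *\<^sub>R y))" if \<theta>: "0 < \<theta>" "\<theta> < 1" for x y \<theta>
  proof -
    have "quad_form W (\<theta> *\<^sub>R x + (1 - \<theta>) *\<^sub>R y) \<le> \<theta> * quad_form W x + (1 - \<theta>) * quad_form W y"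
      using \<theta> by (simp add: quad_form_convex_combination quad_form_nonneg)
    then have "g (\<theta> * quad_form W x + (1 - \<theta>) * quad_form W y) \<le> g (quad_form W (\<theta> *\<^sub>R x + (1 - \<theta>) *\<^sub>R y))"
      by (intro decreasing quad_form_nonneg)
    moreover have "g (quad_form W x) powr \<theta> * g (quad_form W y) powr (1 - \<theta>)
        \<le> g (\<theta> * quad_form W x + (1 - \<theta>) * quad_form W y)"
      using \<theta> by (intro log_concave quad_form_nonneg)
    ultimately show ?thesis by linarith
  qed
  have "convex (support (\<lambda>y. g (quad_form W y)))"
  proof (rule convexI)
    fix x y and u v :: real
    assume xy: "x \<in> support (\<lambda>y. g (quad_form W y))" "y \<in> support (\<lambda>y. g (quad_form W y))"
      and uv: "0 \<le> u" "0 \<le> v" "u + v = 1"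
    consider "u = 0" | "v = 0" | "0 < u" "0 < v" using uv by force
    then show "u *\<^sub>R x + v *\<^sub>R y \<in> support (\<lambda>y. g (quad_form W y))"
    proof cases
      case 3
      have "0 < g (quad_form W x) powr u * g (quad_form W y) powr (1 - u)"
        using xy by (simp add: support_def)
      also have "\<dots> \<le> g (quad_form W (u *\<^sub>R x + (1 - u) *\<^sub>R y))" using uv 3 by (intro ineq) auto
      also have "1 - u = v" using uv by simp
      finally show ?thesis by (simp add: support_def)
    qed (use xy uv in auto)
  qed
  then show ?thesis
    unfolding log_concave_density_def log_concave_on_def using ineq by auto
qed

lemma strictly_log_concave_density_elliptical:
  fixes W :: "real^'m^'m"
  assumes "positive_quad_form W"
    and strict: "\<And>r s. 0 \<le> r \<Longrightarrow> r < s \<Longrightarrow> 0 < g s \<Longrightarrow> g s < g r"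
  shows "strictly_log_concave_density (\<lambda>y. g (quad_form W y))"
proof (rule strictly_log_concave_densityI)
  interpret positive_quad_form W by fact
  fix x y :: "real^'m" and \<theta> :: real
  assume *: "0 < g (quad_form W x)" "0 < g (quad_form W y)" "x \<noteq> y" "0 < \<theta>" "\<theta> < 1"
  have le: "g (quad_form W x) powr \<theta> * g (quad_form W y) powr (1 - \<theta>)
      \<le> g (\<theta> * quad_form W x + (1 - \<theta>) * quad_form W y)"
    using * by (intro log_concave quad_form_nonneg)
  have "0 < g (quad_form W x) powr \<theta> * g (quad_form W y) powr (1 - \<theta>)" using * by simp
  then have "0 < g (\<theta> * quad_form W x + (1 - \<theta>) * quad_form W y)" using le by linarith
  then have "g (\<theta> * quad_form W x + (1 - \<theta>) * quad_form W y) < g (quad_form W (\<theta> *\<^sub>R x + (1 - \<theta>) *\<^sub>R y))"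
    using * by (intro strict quad_form_nonneg quad_form_strictly_convex)
  then show "g (quad_form W x) powr \<theta> * g (quad_form W y) powr (1 - \<theta>)
      < g (quad_form W (\<theta> *\<^sub>R x + (1 - \<theta>) *\<^sub>R y))" using le by linarith
qed

text \<open>
  If \<open>g\<close> were larger at 0 than on \<open>[r, s]\<close>, its logarithm would fail to be concave at \<open>r\<close>.
\<close>

lemma plateau_starts_at_0:
  assumes "0 \<le> r" "r < s" "g s = g r" "0 < g s"
  shows "g s = g 0"
proof (cases "r = 0")
  case False
  define \<theta> where "\<theta> = 1 - r / s"
  have \<theta>: "0 < \<theta>" "\<theta> < 1" using assms False by (auto simp: \<theta>_def)
  have "g 0 powr \<theta> * g s powr (1 - \<theta>) \<le> g (\<theta> * 0 + (1 - \<theta>) * s)"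
    using assms \<theta> by (intro log_concave) auto
  also have "\<theta> * 0 + (1 - \<theta>) * s = r" using assms by (simp add: \<theta>_def)
  also have "g r = g s powr \<theta> * g s powr (1 - \<theta>)" using assms by (simp add: powr_add[symmetric])
  finally have "g 0 powr \<theta> \<le> g s powr \<theta>" using assms(4) by simp
  then have "g 0 \<le> g s" using \<theta> assms(4) pos_at_0 by (meson less_imp_le not_le powr_less_mono2)
  then show ?thesis using decreasing[of 0 s] assms by simp
qed (use assms in simp)

lemma strictly_decreasing_if_no_plateau:
  assumes no_plateau: "\<And>s. 0 < s \<Longrightarrow> g s < g 0"
    and "0 \<le> r" "r < s" "0 < g s"
  shows "g s < g r"
proof -
  have "g s \<noteq> g r" using plateau_starts_at_0[of r s] no_plateau[of s] assms by force
  moreover have "g s \<le> g r" using assms by (intro decreasing) auto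
  ultimately show ?thesis by simp
qed

end

text \<open>
  If \<open>g s = g 0\<close>, then the global maximum is attained on the whole ellipsoid \<open>quad_form W y \<le> s\<close>.
\<close>

lemma (in log_concave_profile) no_plateau_if_unimodal:
  fixes W :: "real^'m^'m"
  assumes "positive_quad_form W" and k: "0 < k"
    and uni: "unimodal (\<lambda>y. k * g (quad_form W y))" and s: "0 < s"
  shows "g s < g 0"
proof (rule ccontr)
  interpret positive_quad_form W by fact
  assume "\<not> ?thesis"
  then have gs: "g 0 \<le> g s" by simp
  have is_mode: "is_mode (\<lambda>y. k * g (quad_form W y)) y" if "quad_form W y \<le> s" for y
  proof -
    have le: "g (quad_form W z) \<le> g (quad_form W y)" for z
      using gs decreasing[OF quad_form_nonneg that] decreasing[OF order_refl quad_form_nonneg[of z]]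
      by linarith
    have "0 < g (quad_form W y)" using le[of 0] pos_at_0 by (simp add: quad_form_0)
    then show ?thesis using k le by (simp add: is_mode_def support_def)
  qed
  obtain y where "y \<noteq> 0" "quad_form W y = s" using quad_form_attains[OF s] .
  then have "is_mode (\<lambda>y. k * g (quad_form W y)) y" "is_mode (\<lambda>y. k * g (quad_form W y)) 0" "y \<noteq> 0"
    using is_mode s by (simp_all add: quad_form_0)
  then show False using uni unfolding unimodal_def by blast
qed

section \<open>Integrating out the first coordinate\<close>

lemma vec_join_convex_combination:
  "\<theta> *\<^sub>R vec_join s x + (1 - \<theta>) *\<^sub>R vec_join t y = vec_join (\<theta> * s + (1 - \<theta>) * t) (\<theta> *\<^sub>R x + (1 - \<theta>) *\<^sub>R y)"
  by (simp add: vec_join_def vec_eq_iff split: option.split)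

lemma vec_join_diff: "vec_join s x - vec_join t y = vec_join (s - t) (x - y)"
  by (simp add: vec_join_def vec_eq_iff split: option.split)

lemma abs_head_le_norm_vec_join: "\<bar>s\<bar> \<le> norm (vec_join s x)"
  using component_le_norm_cart[of "vec_join s x" None] by (simp add: vec_join_def)

lemma abs_tail_le_norm_vec_join: "\<bar>x $ j\<bar> \<le> norm (vec_join s x)"
  using component_le_norm_cart[of "vec_join s x" "Some j"] by (simp add: vec_join_def)

lemma continuous_vec_join: "continuous_on S (\<lambda>p. vec_join (fst p) (snd p))"
  unfolding vec_join_def
proof (rule continuous_on_vec_lambda)
  fix i :: "'a option"
  show "continuous_on S (\<lambda>p. case i of None \<Rightarrow> fst p | Some j \<Rightarrow> snd p $ j)"
    by (cases i) (auto intro!: continuous_intros)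
qed

lemma continuous_vec_join_left: "continuous_on S (\<lambda>u. vec_join u x)"
  using continuous_on_compose2[OF continuous_vec_join[of UNIV], of S "\<lambda>u. (u, x)"]
  by (simp add: continuous_intros)

locale elliptical_profile = log_concave_profile g + positive_quad_form W
  for g :: "real \<Rightarrow> real" and W :: "real^('n::finite option)^('n option)"
begin

definition fiber :: "real^'n \<Rightarrow> real \<Rightarrow> real" where
  "fiber x u = g (quad_form W (vec_join u x))"

lemma fiber_nonneg: "0 \<le> fiber x u"
  by (simp add: fiber_def nonneg quad_form_nonneg)

lemma fiber_le: "fiber x u \<le> g 0"
  by (simp add: fiber_def decreasing quad_form_nonneg)

lemma quad_form_ge_head:
  obtains c where "0 < c" "\<And>u x. c * u\<^sup>2 \<le> quad_form W (vec_join u x)"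
proof -
  obtain c where c: "0 < c" "\<And>y. c * (norm y)\<^sup>2 \<le> quad_form W y"
    using quad_form_coercive by blast
  have "c * u\<^sup>2 \<le> quad_form W (vec_join u x)" for u x
  proof -
    have "\<bar>u\<bar>\<^sup>2 \<le> (norm (vec_join u x))\<^sup>2" using abs_head_le_norm_vec_join by (rule power_mono) simp
    then have "c * u\<^sup>2 \<le> c * (norm (vec_join u x))\<^sup>2" using c(1) by simp
    then show ?thesis using c(2) by (rule order_trans)
  qed
  then show ?thesis using that c(1) by blast
qed

lemma continuous_on_quad_form_fiber: "continuous_on S (\<lambda>u. quad_form W (vec_join u x))"
  by (rule continuous_on_compose2[OF continuous_quad_form[of UNIV] continuous_vec_join_left]) simp

lemma fiber_measurable [measurable]: "fiber x \<in> borel_measurable borel"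
  unfolding fiber_def[abs_def]
  by (intro borel_measurable_comp quad_form_nonneg borel_measurable_continuous_onI continuous_on_quad_form_fiber)

lemma fiber_integrable: "integrable lborel (fiber x)"
proof -
  obtain K c where K: "0 < K" "0 < c" "\<And>r. 0 \<le> r \<Longrightarrow> g r \<le> K * exp (- c * r)"
    using exponential_tail by blast
  obtain b where b: "0 < b" "\<And>u x. b * u\<^sup>2 \<le> quad_form W (vec_join u x)"
    using quad_form_ge_head by blast
  \<comment> \<open>The standard deviation for which \<open>exp (- c * b * u\<^sup>2)\<close> is proportional to the normal density.\<close>
  define \<sigma> where "\<sigma> = 1 / sqrt (2 * c * b)"
  have \<sigma>: "0 < \<sigma>" "\<sigma>\<^sup>2 = 1 / (2 * c * b)" using K b by (simp_all add: \<sigma>_def power_divide)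
  show ?thesis
  proof (rule Bochner_Integration.integrable_bound)
    show "integrable lborel (\<lambda>u. (K * sqrt (2 * pi * \<sigma>\<^sup>2)) * normal_density 0 \<sigma> u)"
      by (intro integrable_mult_right integrable_normal_density \<sigma>)
    show "fiber x \<in> borel_measurable lborel" by simp
    show "AE u in lborel. norm (fiber x u) \<le> norm (K * sqrt (2 * pi * \<sigma>\<^sup>2) * normal_density 0 \<sigma> u)"
    proof (rule AE_I2)
      fix u :: real
      have "fiber x u \<le> K * exp (- c * quad_form W (vec_join u x))"
        unfolding fiber_def by (intro K quad_form_nonneg)
      also have "\<dots> \<le> K * exp (- c * (b * u\<^sup>2))" using K b(2)[of u x] by simp
      also have "\<dots> = K * sqrt (2 * pi * \<sigma>\<^sup>2) * normal_density 0 \<sigma> u"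
        using \<sigma> K b by (simp add: normal_density_def mult_ac)
      finally show "norm (fiber x u) \<le> norm (K * sqrt (2 * pi * \<sigma>\<^sup>2) * normal_density 0 \<sigma> u)"
        using fiber_nonneg[of x u] by simp
    qed
  qed
qed

lemma fiber_superlevel_bounded:
  assumes "0 < \<mu>"
  shows "bounded {u. \<mu> < fiber x u}"
proof -
  obtain R where R: "0 \<le> R" "g R < \<mu>" using vanishing[OF assms] by blast
  obtain b where b: "0 < b" "\<And>u x. b * u\<^sup>2 \<le> quad_form W (vec_join u x)"
    using quad_form_ge_head by blast
  have "norm u \<le> sqrt (R / b)" if "\<mu> < fiber x u" for u
  proof -
    have "quad_form W (vec_join u x) < R"
      using profile_less_imp[of "quad_form W (vec_join u x)" R] that R by (simp add: quad_form_nonneg fiber_def)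
    then have "u\<^sup>2 \<le> R / b" using b(1) b(2)[of u x] by (simp add: pos_le_divide_eq mult.commute)
    then show ?thesis by (simp add: real_le_rsqrt)
  qed
  then show ?thesis unfolding bounded_iff by blast
qed

text \<open>
  Log-concavity across fibers, with \<open>w\<close> not tied to \<open>\<theta> * s + (1 - \<theta>) * t\<close>: any \<open>w\<close> at which the form
  does not exceed the convex combination of its values will do. This room is what produces strictness.
\<close>

lemma fiber_log_concave:
  assumes "0 < \<theta>" "\<theta> < 1"
    and "quad_form W (vec_join w (\<theta> *\<^sub>R x + (1 - \<theta>) *\<^sub>R y))
      \<le> \<theta> * quad_form W (vec_join s x) + (1 - \<theta>) * quad_form W (vec_join t y)"
  shows "fiber x s powr \<theta> * fiber y t powr (1 - \<theta>) \<le> fiber (\<theta> *\<^sub>R x + (1 - \<theta>) *\<^sub>R y) w"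
proof -
  have "fiber x s powr \<theta> * fiber y t powr (1 - \<theta>)
      \<le> g (\<theta> * quad_form W (vec_join s x) + (1 - \<theta>) * quad_form W (vec_join t y))"
    unfolding fiber_def using assms by (intro log_concave quad_form_nonneg) auto
  also have "\<dots> \<le> fiber (\<theta> *\<^sub>R x + (1 - \<theta>) *\<^sub>R y) w"
    unfolding fiber_def using assms by (intro decreasing quad_form_nonneg) auto
  finally show ?thesis .
qed

lemma fiber_quasi_concave:
  assumes "\<nu> < fiber x u" "\<nu> < fiber x v" "u \<le> w" "w \<le> v"
  shows "\<nu> < fiber x w"
proof (cases "u = v")
  case False
  define \<theta> where "\<theta> = (v - w) / (v - u)"
  have uv: "u < v" using assms False by simp
  have \<theta>: "0 \<le> \<theta>" "\<theta> \<le> 1" using assms uv by (auto simp: \<theta>_def divide_simps)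
  have w: "w = \<theta> * u + (1 - \<theta>) * v"
  proof -
    have "\<theta> * (v - u) = v - w" using uv by (simp add: \<theta>_def)
    then show ?thesis by (simp add: algebra_simps)
  qed
  define M where "M = max (quad_form W (vec_join u x)) (quad_form W (vec_join v x))"
  have "vec_join w x = \<theta> *\<^sub>R vec_join u x + (1 - \<theta>) *\<^sub>R vec_join v x"
    unfolding vec_join_convex_combination w by (simp add: scaleR_left_distrib[symmetric])
  then have "quad_form W (vec_join w x)
      \<le> \<theta> * quad_form W (vec_join u x) + (1 - \<theta>) * quad_form W (vec_join v x)"
    using \<theta> by (simp add: quad_form_convex_combination quad_form_nonneg)
  also have "\<dots> \<le> \<theta> * M + (1 - \<theta>) * M"
    using \<theta> by (intro add_mono mult_left_mono) (auto simp: M_def)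
  also have "\<dots> = M" by (simp add: algebra_simps)
  finally have "g M \<le> fiber x w" unfolding fiber_def by (intro decreasing quad_form_nonneg)
  moreover have "\<nu> < g M" using assms by (auto simp: M_def fiber_def max_def)
  ultimately show ?thesis by simp
qed (use assms in auto)

end

lemma measure_superset_interval:
  fixes K :: "real set"
  assumes "bounded K" "K \<in> sets borel" "{a<..<b} \<subseteq> K"
  shows "b - a \<le> measure lborel K"
proof (cases "a \<le> b")
  case True
  have "b - a = measure lborel {a<..<b}" using True by simp
  also have "\<dots> \<le> measure lborel K"
    using assms emeasure_bounded_finite[OF assms(1)]
    by (intro measure_mono_fmeasurable) (auto simp: fmeasurable_def)
  finally show ?thesis .
next
  case False
  then show ?thesis using measure_nonneg[of lborel K] by linarith
qed

lemma measure_le_Sup_minus_Inf: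
  fixes I :: "real set"
  assumes "bounded I" "I \<in> sets borel" "I \<noteq> {}"
  shows "measure lborel I \<le> Sup I - Inf I"
proof -
  have bdd: "bdd_above I" "bdd_below I"
    using assms(1) by (auto intro: bounded_imp_bdd_above bounded_imp_bdd_below)
  have "I \<subseteq> {Inf I..Sup I}" using bdd by (auto intro: cInf_lower cSup_upper)
  moreover have "Inf I \<le> Sup I" using bdd assms(3) by (rule_tac cInf_le_cSup)
  ultimately show ?thesis
    using measure_mono_fmeasurable[of I "{Inf I..Sup I}" lborel] assms(2)
    by (simp add: fmeasurable_def)
qed

context elliptical_profile
begin

text \<open>
  Let \<open>I\<close>, \<open>J\<close>, \<open>K\<close> be the three superlevel sets, in this order. A point \<open>\<theta> * s + (1 - \<theta>) * t\<close> with
  \<open>s \<in> I\<close> and \<open>t \<in> J\<close> lies in \<open>K\<close> with a margin \<open>\<kappa>\<close> in the value of the quadratic form which does not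
  depend on \<open>s\<close> and \<open>t\<close>. By continuity of the form, \<open>K\<close> contains an interval that extends from the combination of
  the infima of \<open>I\<close> and \<open>J\<close> to a point strictly to the right of the combination of their
  suprema. The extension is to the right because \<open>D\<close> is only assumed to be closed
  upwards: at its left end a half-line cuts off all three sets alike.
\<close>

lemma fiber_superlevel_strict_brunn_minkowski:
  fixes D :: "real set"
  assumes D: "D \<in> sets borel" "\<And>s w. s \<in> D \<Longrightarrow> s \<le> w \<Longrightarrow> w \<in> D"
    and xy: "x \<noteq> y" and \<theta>: "0 < \<theta>" "\<theta> < 1" and lev: "0 < \<mu>" "0 < \<nu>"
    and ne: "{u\<in>D. \<mu> < fiber x u} \<noteq> {}" "{u\<in>D. \<nu> < fiber y u} \<noteq> {}"
  shows "\<theta> * measure lborel {u\<in>D. \<mu> < fiber x u} + (1 - \<theta>) * measure lborel {u\<in>D. \<nu> < fiber y u}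
    < measure lborel {u\<in>D. \<mu> powr \<theta> * \<nu> powr (1 - \<theta>) < fiber (\<theta> *\<^sub>R x + (1 - \<theta>) *\<^sub>R y) u}"
proof -
  define z where "z = \<theta> *\<^sub>R x + (1 - \<theta>) *\<^sub>R y"
  define \<rho> where "\<rho> = \<mu> powr \<theta> * \<nu> powr (1 - \<theta>)"
  define I where "I = {u\<in>D. \<mu> < fiber x u}"
  define J where "J = {u\<in>D. \<nu> < fiber y u}"
  define K where "K = {u\<in>D. \<rho> < fiber z u}"
  have \<rho>: "0 < \<rho>" using lev by (simp add: \<rho>_def)
  have bounded: "bounded I" "bounded J" "bounded K"
    using fiber_superlevel_bounded lev \<rho> by (auto simp: I_def J_def K_def intro: bounded_subset)
  have meas: "I \<in> sets borel" "J \<in> sets borel" "K \<in> sets borel"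
    using D(1) unfolding I_def J_def K_def by measurable
  have bdd: "bdd_above I" "bdd_below I" "bdd_above J" "bdd_below J"
    using bounded by (auto intro: bounded_imp_bdd_above bounded_imp_bdd_below)
  have ne: "I \<noteq> {}" "J \<noteq> {}" using ne by (auto simp: I_def J_def)

  \<comment> \<open>Coercivity bounds the gain in \<open>quad_form_convex_combination\<close> from below by a nonzero
    coordinate \<open>j\<close> of \<open>x - y\<close>, whatever the first coordinates \<open>s\<close> and \<open>t\<close> are.\<close>
  obtain \<kappa> where \<kappa>: "0 < \<kappa>" "\<And>s t. quad_form W (vec_join (\<theta> * s + (1 - \<theta>) * t) z) + \<kappa>
      \<le> \<theta> * quad_form W (vec_join s x) + (1 - \<theta>) * quad_form W (vec_join t y)"
  proof -
    obtain c where c: "0 < c" "\<And>v. c * (norm v)\<^sup>2 \<le> quad_form W v" using quad_form_coercive by blast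
    obtain j where j: "(x - y) $ j \<noteq> 0" using xy by (auto simp: vec_eq_iff)
    have "c * ((x - y) $ j)\<^sup>2 \<le> quad_form W (vec_join s (x - y))" for s
    proof -
      have "\<bar>(x - y) $ j\<bar>\<^sup>2 \<le> (norm (vec_join s (x - y)))\<^sup>2"
        using abs_tail_le_norm_vec_join by (rule power_mono) simp
      then have "c * ((x - y) $ j)\<^sup>2 \<le> c * (norm (vec_join s (x - y)))\<^sup>2"
        using c(1) by (simp only: power2_abs mult_le_cancel_left_pos)
      then show ?thesis using c(2) by (rule order_trans)
    qed
    then have gap: "\<theta> * (1 - \<theta>) * (c * ((x - y) $ j)\<^sup>2) \<le> \<theta> * (1 - \<theta>) * quad_form W (vec_join s (x - y))" for s
      using \<theta> by (intro mult_left_mono) auto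
    show ?thesis
    proof
      show "0 < \<theta> * (1 - \<theta>) * (c * ((x - y) $ j)\<^sup>2)" using \<theta> c(1) j by simp
      fix s t
      show "quad_form W (vec_join (\<theta> * s + (1 - \<theta>) * t) z) + \<theta> * (1 - \<theta>) * (c * ((x - y) $ j)\<^sup>2)
          \<le> \<theta> * quad_form W (vec_join s x) + (1 - \<theta>) * quad_form W (vec_join t y)"
        using gap[of "s - t"] quad_form_convex_combination[of W \<theta> "vec_join s x" "vec_join t y"]
        unfolding vec_join_convex_combination vec_join_diff z_def by linarith
    qed
  qed
  have in_K: "w \<in> K"
    if "s \<in> I" "t \<in> J" "w \<in> D"
      and w: "quad_form W (vec_join w z) \<le> quad_form W (vec_join (\<theta> * s + (1 - \<theta>) * t) z) + \<kappa>" for s t w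
  proof -
    have "\<mu> powr \<theta> < fiber x s powr \<theta>" "\<nu> powr (1 - \<theta>) < fiber y t powr (1 - \<theta>)"
      using that lev \<theta> by (auto simp: I_def J_def intro!: powr_less_mono2)
    then have "\<rho> < fiber x s powr \<theta> * fiber y t powr (1 - \<theta>)"
      unfolding \<rho>_def using lev by (intro mult_strict_mono) auto
    also have "\<dots> \<le> fiber z w"
      unfolding z_def using \<theta> w \<kappa>(2)[of s t] by (intro fiber_log_concave) (auto simp: z_def)
    finally show ?thesis using that by (simp add: K_def)
  qed

  define w1 where "w1 = \<theta> * Inf I + (1 - \<theta>) * Inf J"
  define w2 where "w2 = \<theta> * Sup I + (1 - \<theta>) * Sup J"
  \<comment> \<open>Two points within \<open>e\<close> of \<open>w2\<close> have form values that differ by less than \<open>\<kappa>\<close>.\<close>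
  obtain e where e: "0 < e" "\<And>w. \<bar>w - w2\<bar> < e \<Longrightarrow>
      \<bar>quad_form W (vec_join w z) - quad_form W (vec_join w2 z)\<bar> < \<kappa> / 2"
  proof -
    have "continuous_on UNIV (\<lambda>w. quad_form W (vec_join w z))" by (rule continuous_on_quad_form_fiber)
    then show ?thesis using that \<kappa>(1) unfolding continuous_on_iff dist_real_def
      by (metis UNIV_I half_gt_zero)
  qed
  obtain s2 where s2: "s2 \<in> I" "Sup I - e < s2" "s2 \<le> Sup I"
    using less_cSup_iff[OF ne(1) bdd(1), of "Sup I - e"] e(1) cSup_upper[OF _ bdd(1)] by auto
  obtain t2 where t2: "t2 \<in> J" "Sup J - e < t2" "t2 \<le> Sup J"
    using less_cSup_iff[OF ne(2) bdd(3), of "Sup J - e"] e(1) cSup_upper[OF _ bdd(3)] by auto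
  \<comment> \<open>The suprema need not be attained, so the margin is used at a nearby point \<open>v\<close>.\<close>
  define v where "v = \<theta> * s2 + (1 - \<theta>) * t2"
  have v: "w2 - e < v" "v \<le> w2"
  proof -
    have "\<theta> * (Sup I - e) + (1 - \<theta>) * (Sup J - e) < v"
      unfolding v_def using \<theta> s2 t2 by (intro add_strict_mono mult_strict_left_mono) auto
    then show "w2 - e < v" by (simp add: w2_def algebra_simps)
    show "v \<le> w2" unfolding v_def w2_def using \<theta> s2 t2 by (intro add_mono mult_left_mono) auto
  qed
  have D_conv: "\<theta> * s + (1 - \<theta>) * t \<in> D" if "s \<in> D" "t \<in> D" for s t
  proof (cases "s \<le> t")
    case True
    then have "(1 - \<theta>) * s \<le> (1 - \<theta>) * t" using \<theta> by (intro mult_left_mono) auto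
    then have "s \<le> \<theta> * s + (1 - \<theta>) * t" by (simp add: algebra_simps)
    then show ?thesis using D(2) that by blast
  next
    case False
    then have "\<theta> * t \<le> \<theta> * s" using \<theta> by (intro mult_left_mono) auto
    then have "t \<le> \<theta> * s + (1 - \<theta>) * t" by (simp add: algebra_simps)
    then show ?thesis using D(2) that by blast
  qed
  have v_D: "v \<in> D" unfolding v_def using s2 t2 by (intro D_conv) (auto simp: I_def J_def)
  have right: "w \<in> K" if "v \<le> w" "w < w2 + e" for w
  proof (rule in_K[OF s2(1) t2(1)])
    show "w \<in> D" using D(2) v_D that by blast
    have "\<bar>w - w2\<bar> < e" "\<bar>v - w2\<bar> < e" using that v by auto
    then have "\<bar>quad_form W (vec_join w z) - quad_form W (vec_join w2 z)\<bar> < \<kappa> / 2"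
        "\<bar>quad_form W (vec_join v z) - quad_form W (vec_join w2 z)\<bar> < \<kappa> / 2"
      by (blast intro: e(2))+
    then show "quad_form W (vec_join w z) \<le> quad_form W (vec_join (\<theta> * s2 + (1 - \<theta>) * t2) z) + \<kappa>"
      unfolding v_def[symmetric] by linarith
  qed
  have "{w1<..<w2 + e} \<subseteq> K"
  proof
    fix w assume w: "w \<in> {w1<..<w2 + e}"
    show "w \<in> K"
    proof (cases "v \<le> w")
      case True then show ?thesis using right w by simp
    next
      case False
      \<comment> \<open>To the left of \<open>v\<close>, a point of \<open>K\<close> near \<open>w1\<close> and \<open>v\<close> itself enclose \<open>w\<close>, and \<open>K\<close> is an interval.\<close>
      obtain s1 where s1: "s1 \<in> I" "s1 < Inf I + (w - w1)"
        using cInf_less_iff[OF ne(1) bdd(2), of "Inf I + (w - w1)"] w by auto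
      obtain t1 where t1: "t1 \<in> J" "t1 < Inf J + (w - w1)"
        using cInf_less_iff[OF ne(2) bdd(4), of "Inf J + (w - w1)"] w by auto
      define u where "u = \<theta> * s1 + (1 - \<theta>) * t1"
      have "u < \<theta> * (Inf I + (w - w1)) + (1 - \<theta>) * (Inf J + (w - w1))"
        unfolding u_def using \<theta> s1 t1 by (intro add_strict_mono mult_strict_left_mono) auto
      also have "\<dots> = w" by (simp add: w1_def algebra_simps)
      finally have uw: "u < w" .
      have "u \<in> D" unfolding u_def using s1 t1 by (intro D_conv) (auto simp: I_def J_def)
      then have "u \<in> K" using \<kappa>(1) by (intro in_K[OF s1(1) t1(1)]) (auto simp: u_def)
      moreover have "v \<in> K" using right[of v] v e(1) by simp
      moreover have "w \<in> D" using D(2) \<open>u \<in> D\<close> uw by (meson less_imp_le)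
      ultimately show ?thesis
        using fiber_quasi_concave[of \<rho> z u v w] uw False by (simp add: K_def)
    qed
  qed
  then have "w2 + e - w1 \<le> measure lborel K"
    by (intro measure_superset_interval bounded meas)
  moreover have "\<theta> * measure lborel I + (1 - \<theta>) * measure lborel J
      \<le> \<theta> * (Sup I - Inf I) + (1 - \<theta>) * (Sup J - Inf J)"
    using \<theta> by (intro add_mono mult_left_mono measure_le_Sup_minus_Inf bounded meas ne) auto
  moreover have "\<theta> * (Sup I - Inf I) + (1 - \<theta>) * (Sup J - Inf J) = w2 - w1"
    by (simp add: w1_def w2_def algebra_simps)
  ultimately show ?thesis using e(1) unfolding I_def J_def K_def \<rho>_def z_def by linarith
qed

lemma fiber_set_integrable:
  "D \<in> sets borel \<Longrightarrow> integrable lborel (\<lambda>u. indicator D u * fiber x u)"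
  using integrable_mult_indicator[OF _ fiber_integrable[of x], of D] by simp

text \<open>
  \<open>D\<close> is the line for the marginal density and the positive half-line for the skew density.
\<close>

lemma strictly_log_concave_fiber_integral:
  fixes D :: "real set"
  assumes D: "D \<in> sets borel" "\<And>s w. s \<in> D \<Longrightarrow> s \<le> w \<Longrightarrow> w \<in> D"
  shows "strictly_log_concave_density (\<lambda>x. LINT u:D|lborel. fiber x u)"
proof -
  define h where "h x = (LINT u|lborel. indicator D u * fiber x u)" for x
  have h_eq: "(\<lambda>x. LINT u:D|lborel. fiber x u) = h" by (simp add: h_def[abs_def] set_lebesgue_integral_def)
  have level_eq: "{u. \<mu> < indicator D u * fiber x u} = {u\<in>D. \<mu> < fiber x u}" if "0 < \<mu>" for \<mu> x
    using that by (auto split: split_indicator)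
  have strict: "h x powr \<theta> * h y powr (1 - \<theta>) < h (\<theta> *\<^sub>R x + (1 - \<theta>) *\<^sub>R y)"
    if "0 < h x" "0 < h y" "x \<noteq> y" "0 < \<theta>" "\<theta> < 1" for x y \<theta>
    unfolding h_def
  proof (rule strict_prekopa_leindler)
    have "indicator D u * fiber x u \<le> g 0" for u x
      using fiber_le[of x u] pos_at_0 by (simp split: split_indicator)
    then show "bdd_above (range (\<lambda>u. indicator D u * fiber x u))"
        "bdd_above (range (\<lambda>u. indicator D u * fiber y u))"
      by (auto intro!: bdd_aboveI)
    fix \<mu> \<nu> :: real
    assume "0 < \<mu>" "0 < \<nu>" "{u. \<mu> < indicator D u * fiber x u} \<noteq> {}" "{u. \<nu> < indicator D u * fiber y u} \<noteq> {}"
    then show "\<theta> * measure lborel {u. \<mu> < indicator D u * fiber x u}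
        + (1 - \<theta>) * measure lborel {u. \<nu> < indicator D u * fiber y u}
        < measure lborel {u. \<mu> powr \<theta> * \<nu> powr (1 - \<theta>) < indicator D u * fiber (\<theta> *\<^sub>R x + (1 - \<theta>) *\<^sub>R y) u}"
      using fiber_superlevel_strict_brunn_minkowski[OF D] that by (simp add: level_eq)
  qed (use that D(1) in \<open>auto simp: fiber_nonneg fiber_set_integrable h_def\<close>)
  then show ?thesis
    unfolding h_eq by (rule strictly_log_concave_densityI)
qed

end

section \<open>Generators of densities with a convex set of modes\<close>

text \<open>
  A bounded decreasing function has a right limit, namely its supremum near the end point.
\<close>

lemma decreasing_bounded_tendsto_at_right:
  fixes h :: "real \<Rightarrow> real"
  assumes e: "0 < e" and anti: "\<And>u v. 0 < u \<Longrightarrow> u \<le> v \<Longrightarrow> v < e \<Longrightarrow> h v \<le> h u"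
    and bdd: "\<And>u. 0 < u \<Longrightarrow> u < e \<Longrightarrow> h u \<le> B"
  obtains l where "(h \<longlongrightarrow> l) (at_right 0)" "\<And>u. 0 < u \<Longrightarrow> u < e \<Longrightarrow> h u \<le> l"
proof -
  define l where "l = (SUP u\<in>{0<..<e}. h u)"
  have bdd': "bdd_above (h ` {0<..<e})" using bdd by (auto intro!: bdd_aboveI)
  have le: "h u \<le> l" if "0 < u" "u < e" for u
    unfolding l_def using that bdd' by (intro cSUP_upper) auto
  have "(h \<longlongrightarrow> l) (at_right 0)"
  proof (rule increasing_tendsto)
    show "\<forall>\<^sub>F u in at_right 0. h u \<le> l"
      using e le by (auto simp: eventually_at_right_field)
    fix x assume "x < l"
    then obtain v where v: "0 < v" "v < e" "x < h v"
      using less_cSUP_iff[OF _ bdd'] e unfolding l_def by auto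
    then have "x < h u" if "0 < u" "u < v" for u using anti[of u v] that by simp
    then show "\<forall>\<^sub>F u in at_right 0. x < h u" using v by (auto simp: eventually_at_right_field)
  qed
  then show ?thesis using that le by blast
qed

text \<open>
  What a mode at the origin says about the generator: the value \<open>Lim (at_right 0) f\<close>, by which the density is
  extended to the origin, is positive and a local maximum. The operator \<open>Lim\<close> denotes an
  arbitrary number when there is no limit; that the limit exists has to be derived (\<open>gen_tendsto_Lim\<close>).
\<close>

locale peaked_generator =
  fixes f :: "real \<Rightarrow> real"
  assumes gen_nonneg: "0 < r \<Longrightarrow> 0 \<le> f r"
    and gen_log_concave: "log_concave_on (generator_support f) f"
    and Lim_pos: "0 < Lim (at_right 0) f"
    and le_Lim: "\<forall>\<^sub>F r in at_right 0. f r \<le> Lim (at_right 0) f"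
begin

abbreviation L :: real where "L \<equiv> Lim (at_right 0) f"

lemma mem_support_iff: "r \<in> generator_support f \<longleftrightarrow> 0 < r \<and> 0 < f r"
  by (simp add: generator_support_def)

lemma Lim_eqI: "(f \<longlongrightarrow> l) (at_right 0) \<Longrightarrow> L = l"
  by (rule tendsto_Lim) simp_all

text \<open>
  Otherwise \<open>f\<close> would vanish near 0 and its right limit there would be 0.
\<close>

lemma small_support:
  assumes "0 < e"
  obtains r where "0 < r" "r < e" "0 < f r"
proof -
  have "\<exists>r. 0 < r \<and> r < e \<and> 0 < f r"
  proof (rule ccontr)
    assume "\<not> ?thesis"
    then have "f r = 0" if "0 < r" "r < e" for r using gen_nonneg[of r] that by force
    then have "\<forall>\<^sub>F r in at_right 0. f r = 0"
      using assms by (auto simp: eventually_at_right_field)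
    then have "(f \<longlongrightarrow> 0) (at_right 0)" by (rule tendsto_eventually)
    then show False using Lim_eqI Lim_pos by simp
  qed
  then show ?thesis using that by blast
qed

lemma support_down:
  assumes "0 < r" "r \<le> s" "0 < f s"
  shows "0 < f r"
proof -
  \<comment> \<open>The support is an interval that contains points arbitrarily close to 0.\<close>
  obtain q where q: "0 < q" "q < r" "0 < f q" using small_support[OF assms(1)] by blast
  have "is_interval (generator_support f)"
    using gen_log_concave by (simp add: log_concave_on_def is_interval_convex_1)
  moreover have "q \<in> generator_support f" "s \<in> generator_support f" "q \<le> r"
    using q assms by (simp_all add: mem_support_iff)
  ultimately have "r \<in> generator_support f"
    using assms(2) unfolding is_interval_1 by blast
  then show ?thesis by (simp add: mem_support_iff)
qed

text \<open>
  Log-concavity at the interior point \<open>s\<close>; when \<open>f t > 0\<close>, all of \<open>(0, t]\<close> lies in the support.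
\<close>

lemma interior_bound:
  assumes "0 < r" "r < s" "s < t" "0 < f t"
  obtains \<theta> where "0 < \<theta>" "\<theta> < 1" "f r powr \<theta> * f t powr (1 - \<theta>) \<le> f s"
proof
  define \<theta> where "\<theta> = (t - s) / (t - r)"
  show \<theta>: "0 < (t - s) / (t - r)" "(t - s) / (t - r) < 1" using assms by auto
  have "(t - s) / (t - r) * r + (1 - (t - s) / (t - r)) * t = s"
  proof -
    have "\<theta> * (t - r) = t - s" using assms by (simp add: \<theta>_def)
    then show ?thesis unfolding \<theta>_def[symmetric] by (simp add: algebra_simps)
  qed
  then show "f r powr ((t - s) / (t - r)) * f t powr (1 - (t - s) / (t - r)) \<le> f s"
    using log_concave_onD[OF gen_log_concave _ _ \<theta>, of r t] assms support_down[of r t]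
    by (simp add: mem_support_iff)
qed

lemma min_le_interior:
  assumes "0 < r" "r < s" "s < t" "0 < f t"
  shows "min (f r) (f t) \<le> f s"
proof -
  obtain \<theta> where \<theta>: "0 < \<theta>" "\<theta> < 1" "f r powr \<theta> * f t powr (1 - \<theta>) \<le> f s"
    using interior_bound[OF assms] by blast
  define m where "m = min (f r) (f t)"
  have m: "0 < m" using assms support_down[of r t] by (simp add: m_def)
  have "m = m powr \<theta> * m powr (1 - \<theta>)" using m by (simp add: powr_add[symmetric])
  also have "\<dots> \<le> f r powr \<theta> * f t powr (1 - \<theta>)"
    using m \<theta> by (intro mult_mono powr_mono2) (auto simp: m_def)
  finally show ?thesis using \<theta> by (simp add: m_def)
qed

text \<open>
  Suppose \<open>f s < f t\<close> with \<open>s < t\<close>. Then \<open>f\<close> is non-decreasing on \<open>(0, s)\<close>, so it has a right limit at 0,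
  which is a lower bound there; the local maximum property makes it an upper bound near 0 as well. Thus \<open>f\<close> is
  constant near 0 and larger at \<open>t\<close>, against log-concavity.
\<close>

lemma gen_decreasing:
  assumes "0 < s" "s \<le> t"
  shows "f t \<le> f s"
proof (rule ccontr)
  assume "\<not> ?thesis"
  then have less: "f s < f t" by simp
  then have st: "s < t" using assms by (cases "s = t") auto
  have ft: "0 < f t" using less gen_nonneg[OF assms(1)] by linarith
  have below: "f v \<le> f s" if "0 < v" "v \<le> s" for v
    using min_le_interior[of v s t] that st ft less by (cases "v = s") auto
  have mono: "f u \<le> f v" if "0 < u" "u \<le> v" "v < s" for u v
    using min_le_interior[of u v t] below[of v] that st ft less by (cases "u = v") auto
  obtain l where l: "((\<lambda>r. - f r) \<longlongrightarrow> l) (at_right 0)" "\<And>u. 0 < u \<Longrightarrow> u < s \<Longrightarrow> - f u \<le> l"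
  proof (rule decreasing_bounded_tendsto_at_right[of s "\<lambda>r. - f r" 0])
    show "- f v \<le> - f u" if "0 < u" "u \<le> v" "v < s" for u v using mono[OF that] by simp
    show "- f u \<le> 0" if "0 < u" "u < s" for u using gen_nonneg[OF that(1)] by simp
  qed (use assms(1) in auto)
  have "(f \<longlongrightarrow> - l) (at_right 0)" using tendsto_minus[OF l(1)] by simp
  then have L: "L = - l" by (rule Lim_eqI)
  obtain e where e: "0 < e" "\<And>r. 0 < r \<Longrightarrow> r < e \<Longrightarrow> f r \<le> L"
    using le_Lim by (auto simp: eventually_at_right_field)
  \<comment> \<open>On \<open>(0, v]\<close> both bounds by \<open>L\<close> are available.\<close>
  define v where "v = min e s / 2"
  have v: "0 < v" "v < e" "v < s" using e assms by (auto simp: v_def min_def)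
  have const: "f u = L" if "0 < u" "u \<le> v" for u
  proof (rule antisym)
    show "f u \<le> L" using that v by (intro e(2)) auto
    show "L \<le> f u" using l(2)[of u] that v L by simp
  qed
  obtain \<theta> where \<theta>: "0 < \<theta>" "\<theta> < 1" "f (v / 2) powr \<theta> * f t powr (1 - \<theta>) \<le> f v"
  proof (rule interior_bound)
    show "0 < v / 2" "v / 2 < v" "v < t" "0 < f t" using v st ft by auto
  qed
  have "L < f t" using const[of v] below[of v] v less by simp
  then have "L powr \<theta> * L powr (1 - \<theta>) < L powr \<theta> * f t powr (1 - \<theta>)"
    using Lim_pos \<theta> by (intro mult_strict_left_mono powr_less_mono2) auto
  moreover have "L powr \<theta> * L powr (1 - \<theta>) = L" using Lim_pos by (simp add: powr_add[symmetric])
  ultimately show False using \<theta>(3) const[of v] const[of "v / 2"] v by simp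
qed

lemma gen_le_Lim: assumes "0 < s" shows "f s \<le> L"
proof -
  obtain e where e: "0 < e" "\<And>r. 0 < r \<Longrightarrow> r < e \<Longrightarrow> f r \<le> L"
    using le_Lim by (auto simp: eventually_at_right_field)
  have "f s \<le> f (min (e / 2) s)" using assms e(1) by (intro gen_decreasing) auto
  also have "\<dots> \<le> L" using assms e(1) by (intro e(2)) auto
  finally show ?thesis .
qed

lemma gen_tendsto_Lim: "(f \<longlongrightarrow> L) (at_right 0)"
proof -
  obtain l where "(f \<longlongrightarrow> l) (at_right 0)"
    using decreasing_bounded_tendsto_at_right[of 1 f L] gen_decreasing gen_le_Lim zero_less_one by metis
  then show ?thesis using Lim_eqI by metis
qed

text \<open>
  Passage to the limit \<open>r \<rightarrow> 0\<close> in the left end point. On the right-hand side monotonicity replaces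
  continuity: \<open>f (\<theta> * r + (1 - \<theta>) * s) \<le> f ((1 - \<theta>) * s)\<close>.
\<close>

lemma Lim_log_concave:
  assumes s: "0 < s" and \<theta>: "0 < \<theta>" "\<theta> < 1"
  shows "L powr \<theta> * f s powr (1 - \<theta>) \<le> f ((1 - \<theta>) * s)"
proof (cases "f s = 0")
  case True
  then show ?thesis using s \<theta> gen_nonneg by simp
next
  case False
  then have fs: "0 < f s" using gen_nonneg[OF s] by simp
  have "((\<lambda>r. f r powr \<theta> * f s powr (1 - \<theta>)) \<longlongrightarrow> L powr \<theta> * f s powr (1 - \<theta>)) (at_right 0)"
    using Lim_pos by (intro tendsto_intros gen_tendsto_Lim) simp
  moreover have "\<forall>\<^sub>F r in at_right 0. f r powr \<theta> * f s powr (1 - \<theta>) \<le> f ((1 - \<theta>) * s)"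
    unfolding eventually_at_right_field
  proof (intro exI[of _ s] conjI allI impI s)
    fix r assume r: "0 < r" "r < s"
    have "f r powr \<theta> * f s powr (1 - \<theta>) \<le> f (\<theta> * r + (1 - \<theta>) * s)"
      using log_concave_onD[OF gen_log_concave _ _ \<theta>, of r s] r fs support_down[of r s]
      by (simp add: mem_support_iff)
    also have "\<dots> \<le> f ((1 - \<theta>) * s)" using r \<theta> s by (intro gen_decreasing) auto
    finally show "f r powr \<theta> * f s powr (1 - \<theta>) \<le> f ((1 - \<theta>) * s)" .
  qed
  ultimately show ?thesis by (rule tendsto_upperbound) simp
qed

lemma generator_ext_log_concave_profile:
  assumes vanishing: "\<And>e. 0 < e \<Longrightarrow> \<exists>r\<ge>0. generator_ext f r < e"
  shows "log_concave_profile (generator_ext f)"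
proof
  show "0 \<le> generator_ext f r" if "0 \<le> r" for r
    using that gen_nonneg Lim_pos by (simp add: generator_ext_def)
  show "0 < generator_ext f 0" using Lim_pos by (simp add: generator_ext_def)
  show "generator_ext f s \<le> generator_ext f r" if "0 \<le> r" "r \<le> s" for r s
    using that gen_decreasing gen_le_Lim by (auto simp: generator_ext_def)
  show "generator_ext f r powr \<theta> * generator_ext f s powr (1 - \<theta>) \<le> generator_ext f (\<theta> * r + (1 - \<theta>) * s)"
    if rs: "0 \<le> r" "0 \<le> s" and \<theta>: "0 < \<theta>" "\<theta> < 1" for r s \<theta>
  proof -
    consider "r = 0" "s = 0" | "r = 0" "0 < s" | "0 < r" "s = 0" | "0 < r" "0 < s" using rs by force
    then show ?thesis
    proof cases
      case 1
      then show ?thesis using Lim_pos by (simp add: generator_ext_def powr_add[symmetric])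
    next
      case 2
      then show ?thesis using Lim_log_concave[OF _ \<theta>, of s] \<theta> by (simp add: generator_ext_def)
    next
      case 3
      then show ?thesis using Lim_log_concave[of r "1 - \<theta>"] \<theta> by (simp add: generator_ext_def mult.commute)
    next
      case 4
      have pos: "0 < \<theta> * r + (1 - \<theta>) * s" using 4 \<theta> by (simp add: add_pos_pos)
      show ?thesis
      proof (cases "f r = 0 \<or> f s = 0")
        case True
        then show ?thesis using 4 pos gen_nonneg[OF pos] by (auto simp: generator_ext_def)
      next
        case False
        then have "0 < f r" "0 < f s" using 4 gen_nonneg[of r] gen_nonneg[of s] by auto
        then show ?thesis
          using log_concave_onD[OF gen_log_concave _ _ \<theta>, of r s] 4 pos
          by (simp add: mem_support_iff generator_ext_def)
      qed
    qed
  qed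
  show "\<exists>r\<ge>0. generator_ext f r < e" if "0 < e" for e by (rule vanishing[OF that])
qed

text \<open>
  On a plateau \<open>(0, s]\<close> the strict inequality at the points \<open>s / 2\<close> and \<open>s\<close> would give a value above \<open>L\<close>.
\<close>

lemma no_plateau_if_strictly_log_concave:
  assumes "strictly_log_concave_on (generator_support f) f" "0 < s"
  shows "generator_ext f s < generator_ext f 0"
proof -
  have "f s \<noteq> L"
  proof
    assume eq: "f s = L"
    have half: "f (s / 2) = L" using gen_decreasing[of "s / 2" s] gen_le_Lim[of "s / 2"] eq assms(2) by simp
    have mem: "s / 2 \<in> generator_support f" "s \<in> generator_support f"
      using eq half assms(2) Lim_pos by (simp_all add: mem_support_iff)
    have "f (s / 2) powr (1 / 2) * f s powr (1 - 1 / 2) < f ((1 / 2) *\<^sub>R (s / 2) + (1 - 1 / 2) *\<^sub>R s)"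
      using assms(2) by (intro strictly_log_concave_onD[OF assms(1) mem]) auto
    also have "\<dots> \<le> L" using assms(2) by (intro gen_le_Lim) simp
    finally show False using eq half Lim_pos by (simp add: powr_half_sqrt)
  qed
  then show ?thesis using gen_le_Lim[of s] assms(2) by (simp add: generator_ext_def)
qed

end

text \<open>
  The density is even, so with \<open>y\<close> also \<open>- y\<close> is a mode, and by convexity so is their midpoint 0.
  Along the curve \<open>sqrt r *\<^sub>R v\<close>, with \<open>v\<close> on the unit ellipsoid, the form takes the value \<open>r\<close>, which
  transfers the maximum of the density at the origin to the generator.
\<close>

lemma (in positive_quad_form) mode_imp_peaked_generator:
  assumes k: "0 < k"
    and f: "\<And>r. 0 < r \<Longrightarrow> 0 \<le> f r" "log_concave_on (generator_support f) f"
    and mode: "c_unimodal (\<lambda>y. k * generator_ext f (quad_form W y))"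
  shows "peaked_generator f"
proof -
  define p where "p y = k * generator_ext f (quad_form W y)" for y
  have even: "p (- y) = p y" for y by (simp add: p_def quad_form_uminus)
  have convex: "convex {y. is_mode p y}" and ne: "{y. is_mode p y} \<noteq> {}"
    using mode by (simp_all add: c_unimodal_def p_def[abs_def])
  obtain y where y: "is_mode p y" using ne by blast
  have "is_mode p (- y)"
  proof -
    obtain S where S: "open S" "y \<in> S" "\<And>z. z \<in> S \<Longrightarrow> p z \<le> p y"
      using y unfolding is_mode_def eventually_nhds by blast
    have "open (uminus ` S)" "- y \<in> uminus ` S" using S by (auto intro: open_negations)
    moreover have "p z \<le> p y" if "z \<in> uminus ` S" for z using that S(3) even by auto
    ultimately have "\<forall>\<^sub>F z in nhds (- y). p z \<le> p y" unfolding eventually_nhds by blast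
    then show ?thesis using y by (simp add: is_mode_def even support_def)
  qed
  then have "(1 / 2) *\<^sub>R y + (1 / 2) *\<^sub>R (- y) \<in> {y. is_mode p y}"
    using convexD[OF convex, of y "- y" "1/2" "1/2"] y by simp
  then have mode0: "is_mode p 0" by simp
  have Lim: "p 0 = k * Lim (at_right 0) f" by (simp add: p_def quad_form_0 generator_ext_def)
  obtain v where v: "v \<noteq> 0" "quad_form W v = 1" using quad_form_attains[of 1] by auto
  have "((\<lambda>r. sqrt r *\<^sub>R v) \<longlongrightarrow> sqrt 0 *\<^sub>R v) (at_right 0)"
    by (intro tendsto_intros)
  moreover have "\<forall>\<^sub>F z in nhds 0. p z \<le> p 0" using mode0 by (simp add: is_mode_def)
  ultimately have "\<forall>\<^sub>F r in at_right 0. p (sqrt r *\<^sub>R v) \<le> p 0"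
    using eventually_compose_filterlim[of "\<lambda>z. p z \<le> p 0" "nhds 0" "\<lambda>r. sqrt r *\<^sub>R v" "at_right 0"] by simp
  moreover have "\<forall>\<^sub>F r::real in at_right 0. 0 < r" by (simp add: eventually_at_right_less)
  ultimately have "\<forall>\<^sub>F r in at_right 0. f r \<le> Lim (at_right 0) f"
  proof eventually_elim
    case (elim r)
    then have "k * f r \<le> k * Lim (at_right 0) f"
      unfolding Lim by (simp add: p_def quad_form_scaleR v generator_ext_def)
    then show ?case using k by simp
  qed
  moreover have "0 < Lim (at_right 0) f"
    using mode0 k by (simp add: is_mode_def support_def Lim zero_less_mult_iff)
  ultimately show ?thesis using f by unfold_locales auto
qed

text \<open>
  A positive lower bound for \<open>h\<close> would give the density infinite mass.
\<close>

lemma (in positive_quad_form) normalized_imp_vanishing: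
  assumes k: "0 < k" and fin: "(\<integral>\<^sup>+y. ennreal (k * h (quad_form W y)) \<partial>lborel) < \<infinity>" and e: "0 < e"
  shows "\<exists>r\<ge>0. h r < e"
proof (rule ccontr)
  assume "\<not> ?thesis"
  then have ge: "e \<le> h r" if "0 \<le> r" for r using that by (auto simp: not_less)
  have "\<infinity> = (\<integral>\<^sup>+(y::real^'m). ennreal (k * e) \<partial>lborel)"
    using k e by (simp add: ennreal_mult_top)
  also have "\<dots> \<le> (\<integral>\<^sup>+y. ennreal (k * h (quad_form W y)) \<partial>lborel)"
    using k by (intro nn_integral_mono ennreal_leI mult_left_mono ge quad_form_nonneg) auto
  finally show False using fin by simp
qed

section \<open>The laws of the tail and of the conditioned tail\<close>

lemma vec_join_measurable [measurable]:
  "(\<lambda>p. vec_join (fst p) (snd p)) \<in> borel \<Otimes>\<^sub>M borel \<rightarrow>\<^sub>M borel"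
  using borel_measurable_continuous_onI[OF continuous_vec_join] by (simp add: borel_prod)

lemma vec_head_measurable [measurable]: "vec_head \<in> borel \<rightarrow>\<^sub>M borel"
  unfolding vec_head_def[abs_def] by (intro borel_measurable_continuous_onI continuous_intros)

lemma vec_tail_measurable [measurable]: "vec_tail \<in> borel \<rightarrow>\<^sub>M borel"
  unfolding vec_tail_def[abs_def]
  by (intro borel_measurable_continuous_onI continuous_on_vec_lambda continuous_intros)

lemma vec_head_join [simp]: "vec_head (vec_join a b) = a"
  by (simp add: vec_head_def vec_join_def)

lemma vec_tail_join [simp]: "vec_tail (vec_join a b) = b"
  by (simp add: vec_tail_def vec_join_def)

lemma prod_Basis_vec:
  fixes h :: "real^'m \<Rightarrow> 'b::comm_monoid_mult"
  shows "(\<Prod>b\<in>Basis. h b) = (\<Prod>i\<in>UNIV. h (axis i 1))"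
proof -
  have Basis: "(Basis :: (real^'m) set) = range (\<lambda>i. axis i 1)"
    by (auto simp: Basis_vec_def)
  have inj: "inj (\<lambda>i. axis i 1 :: real^'m)" by (auto simp: inj_on_def axis_eq_axis)
  show ?thesis unfolding Basis by (simp add: prod.reindex[OF inj])
qed

lemma emeasure_lborel_box_vec:
  fixes l u :: "real^'m"
  assumes "\<And>i. l $ i \<le> u $ i"
  shows "emeasure lborel (box l u) = (\<Prod>i\<in>UNIV. ennreal (u $ i - l $ i))"
proof -
  have "l \<bullet> b \<le> u \<bullet> b" if "b \<in> Basis" for b
    using that assms by (auto simp: Basis_vec_def inner_axis)
  then have "emeasure lborel (box l u) = (\<Prod>b\<in>Basis. ennreal ((u - l) \<bullet> b))"
    by (simp add: emeasure_lborel_box prod_ennreal inner_diff_left)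
  then show ?thesis by (simp add: prod_Basis_vec inner_axis)
qed

text \<open>
  Both measures give a box the product of its side lengths.
\<close>

lemma lborel_eq_distr_vec_join:
  "lborel = distr (lborel \<Otimes>\<^sub>M lborel) borel (\<lambda>p. vec_join (fst p) (snd p :: real^'n::finite))"
proof (rule lborel_eqI)
  fix l u :: "real^('n option)"
  assume le_Basis: "\<And>b. b \<in> Basis \<Longrightarrow> l \<bullet> b \<le> u \<bullet> b"
  have le: "l $ i \<le> u $ i" for i
    using le_Basis[of "axis i 1"] by (simp add: inner_axis)
  have "emeasure (distr (lborel \<Otimes>\<^sub>M lborel) borel (\<lambda>p. vec_join (fst p) (snd p :: real^'n))) (box l u)
      = emeasure (lborel \<Otimes>\<^sub>M lborel) ({l $ None<..<u $ None} \<times> box (vec_tail l) (vec_tail u))"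
  proof (subst emeasure_distr)
    have "(vec_join a b \<in> box l u) \<longleftrightarrow> l $ None < a \<and> a < u $ None \<and> b \<in> box (vec_tail l) (vec_tail u)"
      for a and b :: "real^'n"
      unfolding mem_box_cart vec_join_def vec_tail_def
      by (auto split: option.splits)
    then show "emeasure (lborel \<Otimes>\<^sub>M lborel) ((\<lambda>p. vec_join (fst p) (snd p)) -` box l u \<inter> space (lborel \<Otimes>\<^sub>M lborel))
        = emeasure (lborel \<Otimes>\<^sub>M lborel) ({l $ None<..<u $ None} \<times> box (vec_tail l) (vec_tail u))"
      by (intro arg_cong[where f="emeasure (lborel \<Otimes>\<^sub>M lborel)"]) (auto simp: space_pair_measure)
  qed auto
  also have "\<dots> = ennreal (u $ None - l $ None) * (\<Prod>j\<in>UNIV. ennreal (u $ Some j - l $ Some j))"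
    using le by (subst lborel.emeasure_pair_measure_Times)
      (auto simp: emeasure_lborel_box_vec vec_tail_def)
  also have "\<dots> = (\<Prod>i\<in>UNIV. ennreal (u $ i - l $ i))"
    by (simp add: UNIV_option_conv prod.reindex)
  also have "\<dots> = ennreal (\<Prod>b\<in>Basis. (u - l) \<bullet> b)"
    using le by (simp add: prod_Basis_vec inner_axis prod_ennreal)
  finally show "emeasure (distr (lborel \<Otimes>\<^sub>M lborel) borel (\<lambda>p. vec_join (fst p) (snd p :: real^'n))) (box l u)
      = ennreal (\<Prod>b\<in>Basis. (u - l) \<bullet> b)" .
qed simp

lemma lborel_distr_uminus_euclidean:
  "distr lborel borel uminus = (lborel :: 'a::euclidean_space measure)"
  using lborel_affine[of "-1" "0::'a"] by (simp add: density_1)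

lemma distributed_vec_join:
  fixes U :: "'s \<Rightarrow> real^('n::finite option)"
  assumes "distributed M lborel U p"
  shows "distributed M (lborel \<Otimes>\<^sub>M lborel) (\<lambda>\<omega>. (vec_head (U \<omega>), vec_tail (U \<omega>)))
    (\<lambda>q. p (vec_join (fst q) (snd q)))"
proof -
  have U [measurable]: "U \<in> M \<rightarrow>\<^sub>M borel" and p [measurable]: "p \<in> borel_measurable borel"
    and eq: "distr M lborel U = density lborel p"
    using assms by (auto simp: distributed_def)
  let ?N = "lborel \<Otimes>\<^sub>M (lborel :: (real^'n) measure)"
  let ?split = "\<lambda>y. (vec_head y, vec_tail y) :: real \<times> (real^'n)"
  let ?join = "\<lambda>p. vec_join (fst p) (snd p :: real^'n)"
  have split [measurable]: "?split \<in> borel \<rightarrow>\<^sub>M borel \<Otimes>\<^sub>M borel" by measurable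
  have "distr M ?N (\<lambda>\<omega>. ?split (U \<omega>)) = distr (distr M lborel U) ?N ?split"
    by (subst distr_distr) (auto simp: comp_def)
  also have "\<dots> = distr (density (distr ?N borel ?join) p) ?N ?split"
    unfolding eq by (subst lborel_eq_distr_vec_join) (rule refl)
  also have "density (distr ?N borel ?join) p = distr (density ?N (\<lambda>q. p (?join q))) borel ?join"
    by (rule density_distr) auto
  also have "distr (distr (density ?N (\<lambda>q. p (?join q))) borel ?join) ?N ?split
      = distr (density ?N (\<lambda>q. p (?join q))) ?N (\<lambda>q. q)"
    by (subst distr_distr) (auto simp: comp_def)
  also have "\<dots> = density ?N (\<lambda>q. p (?join q))"
    by (rule distr_id2) simp
  finally show ?thesis by (auto simp: distributed_def)
qed

text \<open>
  The events \<open>head > 0\<close> and \<open>head < 0\<close> are equally likely by reflection, and \<open>head\<close> has a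
  density, hence is almost surely nonzero.
\<close>

lemma (in prob_space) prob_head_positive:
  fixes U :: "'a \<Rightarrow> real^('n::finite option)"
  assumes U: "distributed M lborel U p" and even: "\<And>y. p (- y) = p y"
  shows "emeasure M {\<omega> \<in> space M. 0 < vec_head (U \<omega>)} = ennreal (1 / 2)"
proof -
  have U' [measurable]: "U \<in> M \<rightarrow>\<^sub>M borel" and p [measurable]: "p \<in> borel_measurable borel"
    using U by (auto simp: distributed_def)
  have ev: "emeasure M {\<omega> \<in> space M. U \<omega> \<in> S} = (\<integral>\<^sup>+y. p y * indicator S y \<partial>lborel)" if "S \<in> sets borel" for S
    using distributed_emeasure[OF U, of S] that by (simp add: vimage_def Int_def conj_commute)
  define Pos where "Pos = {\<omega> \<in> space M. 0 < vec_head (U \<omega>)}"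
  define Neg where "Neg = {\<omega> \<in> space M. vec_head (U \<omega>) < 0}"
  define Zero where "Zero = {\<omega> \<in> space M. vec_head (U \<omega>) = 0}"
  have sets [measurable]: "Pos \<in> sets M" "Neg \<in> sets M" "Zero \<in> sets M"
    unfolding Pos_def Neg_def Zero_def by measurable
  have "emeasure M Pos = (\<integral>\<^sup>+y. p y * indicator {y. 0 < vec_head y} y \<partial>lborel)"
    using ev[of "{y. 0 < vec_head y}"] by (simp add: Pos_def)
  also have "\<dots> = (\<integral>\<^sup>+y. p y * indicator {y. 0 < vec_head y} y \<partial>distr lborel borel uminus)"
    by (simp add: lborel_distr_uminus_euclidean)
  also have "\<dots> = (\<integral>\<^sup>+y. p (- y) * indicator {y. 0 < vec_head y} (- y) \<partial>lborel)"
    by (rule nn_integral_distr) measurable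
  also have "\<dots> = (\<integral>\<^sup>+y. p y * indicator {y. vec_head y < 0} y \<partial>lborel)"
    by (intro nn_integral_cong) (simp add: even vec_head_def split: split_indicator)
  also have "\<dots> = emeasure M Neg"
    using ev[of "{y. vec_head y < 0}"] by (simp add: Neg_def)
  finally have sym: "emeasure M Pos = emeasure M Neg" .
  have zero: "emeasure M Zero = 0"
  proof -
    have "distributed M lborel (\<lambda>\<omega>. vec_head (U \<omega>)) (\<lambda>a. \<integral>\<^sup>+b. p (vec_join a b) \<partial>lborel)"
      using distr_marginal1[OF sigma_finite_lborel sigma_finite_lborel distributed_vec_join[OF U]] by simp
    then have "emeasure M ((\<lambda>\<omega>. vec_head (U \<omega>)) -` {0} \<inter> space M)
        = (\<integral>\<^sup>+a. (\<integral>\<^sup>+b. p (vec_join a b) \<partial>lborel) * indicator {0} a \<partial>lborel)"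
      by (rule distributed_emeasure) simp
    also have "\<dots> = (\<integral>\<^sup>+(a::real). 0 \<partial>lborel)"
      using AE_lborel_singleton[of "0::real"] by (intro nn_integral_cong_AE) auto
    finally show ?thesis by (simp add: Zero_def vimage_def Int_def conj_commute)
  qed
  have "space M = Pos \<union> Neg \<union> Zero" by (auto simp: Pos_def Neg_def Zero_def)
  then have "1 = emeasure M (Pos \<union> Neg \<union> Zero)" using emeasure_space_1 by simp
  also have "\<dots> = emeasure M (Pos \<union> Neg) + emeasure M Zero"
    by (rule plus_emeasure[symmetric]) (auto simp: Pos_def Neg_def Zero_def)
  also have "emeasure M (Pos \<union> Neg) = emeasure M Pos + emeasure M Neg"
    by (rule plus_emeasure[symmetric]) (auto simp: Pos_def Neg_def)
  finally have "1 = emeasure M Pos + emeasure M Pos" using sym zero by simp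
  then have "ennreal (prob Pos + prob Pos) = 1"
    by (simp only: emeasure_eq_measure ennreal_plus[symmetric] measure_nonneg)
  then have "prob Pos + prob Pos = 1" by (simp only: ennreal_eq_1)
  then have "prob Pos = 1 / 2" by simp
  then have "emeasure M Pos = ennreal (1 / 2)" by (simp only: emeasure_eq_measure)
  then show ?thesis by (simp only: Pos_def)
qed

text \<open>
  The factor 2 is the reciprocal of the probability of the conditioning event.
\<close>

lemma (in prob_space) distributed_tail_given_head_positive:
  fixes U :: "'a \<Rightarrow> real^('n::finite option)"
  assumes U: "distributed M lborel U p" and even: "\<And>y. p (- y) = p y"
  shows "distributed (uniform_measure M {\<omega> \<in> space M. vec_head (U \<omega>) > 0}) lborel (\<lambda>\<omega>. vec_tail (U \<omega>))
    (\<lambda>b. 2 * (\<integral>\<^sup>+a. p (vec_join a b) * indicator {0<..} a \<partial>lborel))"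
proof -
  have U' [measurable]: "U \<in> M \<rightarrow>\<^sub>M borel" and p [measurable]: "p \<in> borel_measurable borel"
    using U by (auto simp: distributed_def)
  define E where "E = {\<omega> \<in> space M. 0 < vec_head (U \<omega>)}"
  have E [measurable]: "E \<in> sets M" unfolding E_def by measurable
  define h where "h b = (\<integral>\<^sup>+a. p (vec_join a b) * indicator {0<..} a \<partial>lborel)" for b :: "real^'n"
  have [measurable]: "(\<lambda>q. p (vec_join (snd q) (fst q)) * indicator {0<..} (snd q)) \<in> borel_measurable (borel \<Otimes>\<^sub>M borel)"
    using measurable_compose[OF measurable_Pair[OF measurable_snd measurable_fst] vec_join_measurable[THEN measurable_compose, OF p]]
    by simp
  have h [measurable]: "h \<in> borel_measurable borel" unfolding h_def by measurable
  have "distr (uniform_measure M E) lborel (\<lambda>\<omega>. vec_tail (U \<omega>)) = density lborel (\<lambda>b. 2 * h b)"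
  proof (rule measure_eqI)
    fix B assume "B \<in> sets (distr (uniform_measure M E) lborel (\<lambda>\<omega>. vec_tail (U \<omega>)))"
    then have B [measurable]: "B \<in> sets borel" by simp
    let ?T = "(\<lambda>\<omega>. vec_tail (U \<omega>)) -` B \<inter> space M"
    have T: "?T \<in> sets M" by measurable
    have "emeasure (distr (uniform_measure M E) lborel (\<lambda>\<omega>. vec_tail (U \<omega>))) B = emeasure M (E \<inter> ?T) / emeasure M E"
      using T by (subst emeasure_distr) auto
    also have "emeasure M E = ennreal (1 / 2)"
      unfolding E_def by (rule prob_head_positive[OF U even])
    also have "emeasure M (E \<inter> ?T) / ennreal (1 / 2) = 2 * emeasure M (E \<inter> ?T)"
    proof -
      have "inverse (ennreal (1 / 2)) = 2" by (subst inverse_ennreal) auto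
      then show ?thesis by (simp only: divide_ennreal_def mult.commute)
    qed
    also have "E \<inter> ?T = (\<lambda>\<omega>. (vec_head (U \<omega>), vec_tail (U \<omega>))) -` ({0<..} \<times> B) \<inter> space M"
      by (auto simp: E_def)
    also have "emeasure M \<dots> = (\<integral>\<^sup>+q. p (vec_join (fst q) (snd q)) * indicator ({0<..} \<times> B) q \<partial>(lborel \<Otimes>\<^sub>M lborel))"
      by (rule distributed_emeasure[OF distributed_vec_join[OF U]]) simp
    also have "\<dots> = (\<integral>\<^sup>+b. \<integral>\<^sup>+a. p (vec_join a b) * indicator ({0<..} \<times> B) (a, b) \<partial>lborel \<partial>lborel)"
      by (subst lborel_pair.nn_integral_snd[symmetric]) auto
    also have "\<dots> = (\<integral>\<^sup>+b. h b * indicator B b \<partial>lborel)"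
      unfolding h_def by (intro nn_integral_cong) (auto simp: indicator_def intro!: nn_integral_cong)
    also have "2 * \<dots> = (\<integral>\<^sup>+b. (2 * h b) * indicator B b \<partial>lborel)"
      by (subst nn_integral_cmult[symmetric]) (auto simp: mult.assoc)
    also have "\<dots> = emeasure (density lborel (\<lambda>b. 2 * h b)) B"
      by (rule emeasure_density[symmetric]) auto
    finally show "emeasure (distr (uniform_measure M E) lborel (\<lambda>\<omega>. vec_tail (U \<omega>))) B
        = emeasure (density lborel (\<lambda>b. 2 * h b)) B" .
  qed simp
  then show ?thesis unfolding distributed_def E_def h_def[symmetric] by simp
qed

section \<open>Log-concavity of skew-elliptical densities\<close>

theorem proposition12:
  fixes M :: "'s measure"
    and U :: "'s \<Rightarrow> real^('n::finite option)"
    and \<delta> :: "real^'n" and \<Omega> :: "real^'n^'n"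
    and f :: "real \<Rightarrow> real"
  assumes "prob_space M"
    and "has_elliptical_density M U (Omega_plus \<delta> \<Omega>) f"
    and "\<forall>i. Omega_plus \<delta> \<Omega> $ i $ i = 1"
    and "c_unimodal (elliptical_density (Omega_plus \<delta> \<Omega>) f)"
    and "log_concave_on (generator_support f) f"
  shows
    "distributed M lborel (\<lambda>\<omega>. vec_tail (U \<omega>))
       (\<lambda>y. ennreal (marginal_density \<delta> \<Omega> f y)) \<and>
     distributed (uniform_measure M {\<omega> \<in> space M. vec_head (U \<omega>) > 0}) lborel
       (\<lambda>\<omega>. vec_tail (U \<omega>)) (\<lambda>y. ennreal (skew_elliptical_density \<delta> \<Omega> f y)) \<and>
     log_concave_density (elliptical_density (Omega_plus \<delta> \<Omega>) f) \<and>
     log_concave_density (marginal_density \<delta> \<Omega> f) \<and>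
     log_concave_density (skew_elliptical_density \<delta> \<Omega> f) \<and>
     (unimodal (elliptical_density (Omega_plus \<delta> \<Omega>) f) \<or>
      strictly_log_concave_on (generator_support f) f \<longrightarrow>
        strictly_log_concave_density (elliptical_density (Omega_plus \<delta> \<Omega>) f)) \<and>
     (unimodal (elliptical_density (Omega_plus \<delta> \<Omega>) f) \<or>
      strictly_log_concave_on (generator_support f) f \<or>
      bounded (generator_support f) \<longrightarrow>
        strictly_log_concave_density (marginal_density \<delta> \<Omega> f) \<and>
        strictly_log_concave_density (skew_elliptical_density \<delta> \<Omega> f))"
proof -
  interpret prob_space M by fact
  have pos_def: "pos_def_matrix (Omega_plus \<delta> \<Omega>)"
    and gen: "density_generator CARD('n option) f"
    and U: "distributed M lborel U (\<lambda>y. ennreal (elliptical_density (Omega_plus \<delta> \<Omega>) f y))"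
    using assms(2) by (simp_all add: has_elliptical_density_def)
  define W where "W = matrix_inv (Omega_plus \<delta> \<Omega>)"
  define g where "g = generator_ext f"
  define k where "k = 1 / (LINT x|lborel. elliptical_kernel (Omega_plus \<delta> \<Omega>) f x)"
  define p where "p = elliptical_density (Omega_plus \<delta> \<Omega>) f"
  have W: "positive_quad_form W"
    unfolding W_def by (rule pos_def_matrix_imp_positive_quad_form_inv[OF pos_def])
  interpret positive_quad_form W by (rule W)
  have kernel: "elliptical_kernel (Omega_plus \<delta> \<Omega>) f = (\<lambda>y. g (quad_form W y))"
    by (simp add: fun_eq_iff elliptical_kernel_def g_def W_def quad_form_def)
  have p: "p = (\<lambda>y. k * g (quad_form W y))"
    by (simp add: fun_eq_iff p_def elliptical_density_def k_def kernel)
  have f_nonneg: "0 \<le> f r" if "0 < r" for r using gen that by (simp add: density_generator_def)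

  \<comment> \<open>The kernel is known to be non-negative only away from the origin, hence almost everywhere.\<close>
  have "0 \<le> k"
  proof -
    have "AE y in lborel. 0 \<le> g (quad_form W y)"
      using AE_lborel_singleton[of 0]
      by eventually_elim (simp add: g_def generator_ext_def quad_form_pos f_nonneg)
    then show ?thesis unfolding k_def kernel by (simp add: integral_nonneg_AE)
  qed
  \<comment> \<open>Were the normalizing integral 0, division by it would make the density vanish, and it would have no mode.\<close>
  moreover have "k \<noteq> 0"
    using assms(4) unfolding p_def[symmetric] p by (auto simp: c_unimodal_def is_mode_def support_def)
  ultimately have k: "0 < k" by simp

  interpret peaked_generator f
    using mode_imp_peaked_generator[OF k f_nonneg assms(5)] assms(4) p
    unfolding p_def[symmetric] g_def by simp
  have U_p: "distributed M lborel U (\<lambda>y. ennreal (p y))" using U by (simp add: p_def)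
  have total: "(\<integral>\<^sup>+y. ennreal (k * g (quad_form W y)) \<partial>lborel) = 1"
    using distributed_emeasure[OF U_p, of UNIV] emeasure_space_1 by (simp add: p)
  have profile: "log_concave_profile g"
    unfolding g_def
  proof (rule generator_ext_log_concave_profile)
    show "\<exists>r\<ge>0. generator_ext f r < e" if "0 < e" for e
      using normalized_imp_vanishing[OF k _ that, of g] total by (simp add: g_def)
  qed
  interpret elliptical_profile g W
    using profile W by (simp add: elliptical_profile_def)

  have p_join: "p (vec_join a b) = k * fiber b a" for a b by (simp add: p fiber_def)
  have p_nonneg: "0 \<le> p y" for y using k by (simp add: p nonneg quad_form_nonneg)
  have p_even: "p (- y) = p y" for y by (simp add: p quad_form_uminus)
  have marginal: "marginal_density \<delta> \<Omega> f = (\<lambda>b. k * (LINT a:UNIV|lborel. fiber b a))"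
    unfolding marginal_density_def p_def[symmetric] p_join fun_eq_iff
    by (simp add: set_lebesgue_integral_def)
  have skew: "skew_elliptical_density \<delta> \<Omega> f = (\<lambda>b. (2 * k) * (LINT a:{0<..}|lborel. fiber b a))"
    unfolding skew_elliptical_density_def p_def[symmetric] p_join fun_eq_iff by simp

  have "distributed M lborel (\<lambda>\<omega>. vec_tail (U \<omega>)) (\<lambda>b. \<integral>\<^sup>+a. ennreal (p (vec_join a b)) \<partial>lborel)"
    using distr_marginal2[OF sigma_finite_lborel sigma_finite_lborel distributed_vec_join[OF U_p]] by simp
  moreover have "(\<integral>\<^sup>+a. ennreal (p (vec_join a b)) \<partial>lborel) = ennreal (marginal_density \<delta> \<Omega> f b)" for b
    unfolding p_join marginal using fiber_integrable[of b] k
    by (subst nn_integral_eq_integral) (auto simp: fiber_nonneg set_lebesgue_integral_def)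
  ultimately have dist_marginal: "distributed M lborel (\<lambda>\<omega>. vec_tail (U \<omega>))
      (\<lambda>y. ennreal (marginal_density \<delta> \<Omega> f y))" by simp

  have "distributed (uniform_measure M {\<omega> \<in> space M. vec_head (U \<omega>) > 0}) lborel (\<lambda>\<omega>. vec_tail (U \<omega>))
      (\<lambda>b. 2 * (\<integral>\<^sup>+a. ennreal (p (vec_join a b)) * indicator {0<..} a \<partial>lborel))"
    by (rule distributed_tail_given_head_positive[OF U_p]) (simp add: p_even)
  moreover have "2 * (\<integral>\<^sup>+a. ennreal (p (vec_join a b)) * indicator {0<..} a \<partial>lborel)
      = ennreal (skew_elliptical_density \<delta> \<Omega> f b)" for b
  proof -
    have "(\<integral>\<^sup>+a. ennreal (p (vec_join a b)) * indicator {0<..} a \<partial>lborel)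
        = (\<integral>\<^sup>+a. ennreal (k * (indicator {0<..} a * fiber b a)) \<partial>lborel)"
      by (intro nn_integral_cong) (simp add: p_join split: split_indicator)
    also have "\<dots> = ennreal (k * (LINT a:{0<..}|lborel. fiber b a))"
      using fiber_set_integrable[of "{0<..}" b] k
      by (subst nn_integral_eq_integral) (auto simp: fiber_nonneg set_lebesgue_integral_def)
    finally have *: "(\<integral>\<^sup>+a. ennreal (p (vec_join a b)) * indicator {0<..} a \<partial>lborel)
        = ennreal (k * (LINT a:{0<..}|lborel. fiber b a))" .
    have "0 \<le> k * (LINT a:{0<..}|lborel. fiber b a)"
      using k by (simp add: set_lebesgue_integral_def fiber_nonneg)
    then show ?thesis unfolding * skew by (simp add: ennreal_mult mult.assoc)
  qed
  ultimately have dist_skew: "distributed (uniform_measure M {\<omega> \<in> space M. vec_head (U \<omega>) > 0}) lborel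
      (\<lambda>\<omega>. vec_tail (U \<omega>)) (\<lambda>y. ennreal (skew_elliptical_density \<delta> \<Omega> f y))" by simp

  have strict_marginal: "strictly_log_concave_density (marginal_density \<delta> \<Omega> f)"
    unfolding marginal using k
    by (intro strictly_log_concave_density_scale strictly_log_concave_fiber_integral) auto
  have strict_skew: "strictly_log_concave_density (skew_elliptical_density \<delta> \<Omega> f)"
    unfolding skew using k
    by (intro strictly_log_concave_density_scale strictly_log_concave_fiber_integral) auto
  have lc: "log_concave_density p"
    unfolding p by (intro log_concave_density_scale k log_concave_density_elliptical W)
  \<comment> \<open>Both alternatives say that \<open>g\<close> has no plateau at the origin, and log-concavity excludes any other plateau.\<close>
  have strict: "strictly_log_concave_density p"
    if "unimodal p \<or> strictly_log_concave_on (generator_support f) f"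
  proof -
    have no_plateau: "g s < g 0" if "0 < s" for s
      using \<open>unimodal p \<or> _\<close>
    proof
      assume "unimodal p"
      then show ?thesis using no_plateau_if_unimodal[OF W k _ that] by (simp add: p)
    next
      assume "strictly_log_concave_on (generator_support f) f"
      then show ?thesis unfolding g_def using that by (rule no_plateau_if_strictly_log_concave)
    qed
    show ?thesis
      unfolding p using strictly_decreasing_if_no_plateau[OF no_plateau]
      by (intro strictly_log_concave_density_scale k strictly_log_concave_density_elliptical W)
  qed
  show ?thesis
    using dist_marginal dist_skew lc strict strict_marginal strict_skew
      strictly_log_concave_imp_log_concave[OF strict_marginal]
      strictly_log_concave_imp_log_concave[OF strict_skew]
    unfolding p_def by blast
qed

end
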